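(* Let $G$ be a finite directed graph and let $\lambda$ be a left-bounded left weight on $G$ with canonical right companion $\rho$. Let $G^+_\rho=\{u\in G^+ : \rho(u)<\infty\}$. If for every $v\in G^+$ there exists $u_v\in G^+_\rho$ such that $vu_v\in G^+_\rho$, then $\mathfrak{L}(G,\lambda)''=\mathfrak{L}(G,\lambda)$.
   Context: $G$ is a directed graph (multiple edges and loops allowed) with vertex set $V(G)$ and edge set $E(G)$; finite means that both $V(G)$ and $E(G)$ are finite. $G^+$ is the set of all finite directed paths in $G$, including the vertices as paths of length $0$; $s(w)$, $r(w)$ are the source and range vertices of a path $w$, with $s(x)=r(x)=x$ for $x\in V(G)$. Paths are composed right to left: $w=r(w)\,w\,s(w)$, and for $v,w\in G^+$ one has $wv\in G^+$ if and only if $s(w)=r(v)$. $\mathcal{H}_G=\ell^2(G^+)$ with canonical orthonormal basis $\{\xi_v : v\in G^+\}$; commutants are taken in $\mathcal{B}(\mathcal{H}_G)$. A left weight on $G$ is a function $\lambda: G^+\times G^+\to[0,\infty)$ such that $\lambda(v,w)>0\iff wv\in G^+$, and $\lambda(v,w_2w_1)=\lambda(w_1v,w_2)\lambda(v,w_1)$ whenever $w_2w_1v\in G^+$. Put $\lambda(w)=\sup_{v\in G^+}\lambda(v,w)\in[0,\infty]$. $\lambda$ is left-bounded if $\lambda(w)<\infty$ for all $w\in G^+$. If $\lambda(w)<\infty$, $L_{\lambda,w}\in\mathcal{B}(\mathcal{H}_G)$ is the bounded operator with $L_{\lambda,w}\xi_v=\lambda(v,w)\xi_{wv}$ if $wv\in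 G^+$ and $L_{\lambda,w}\xi_v=0$ otherwise. $\mathfrak{L}(G,\lambda)$ is the WOT-closed unital operator algebra generated by $\{L_{\lambda,w}: w\in G^+,\ \lambda(w)<\infty\}$. A right weight on $G$ is a function $\rho:G^+\times G^+\to[0,\infty)$ such that $\rho(v,u)>0\iff vu\in G^+$, and $\rho(v,u_1u_2)=\rho(vu_1,u_2)\rho(v,u_1)$ whenever $vu_1u_2\in G^+$. Put $\rho(u)=\sup_{v\in G^+}\rho(v,u)\in[0,\infty]$. A right weight $\rho$ is a right companion to $\lambda$ if $\rho(wv,u)\lambda(v,w)=\lambda(vu,w)\rho(v,u)$ for all $v,w,u\in G^+$ with $wvu\in G^+$. It is canonical if moreover $\rho(r(e),e)=\lambda(s(e),e)$ for all $e\in E(G)$. Every left weight has exactly one canonical right companion. *)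

theory Defs
  imports "HOL-Analysis.Analysis" "Graph_Theory.Arc_Walk"
begin

section \<open>Bounded operators on the Hilbert space of a set\<close>

text \<open>Vectors are functions that vanish outside the index set \<open>S\<close>, so that they are
  determined by their coordinates in \<open>S\<close>.\<close>

definition ell2 :: "'i set \<Rightarrow> ('i \<Rightarrow> complex) set" where
  "ell2 S = {x. (\<forall>i. i \<notin> S \<longrightarrow> x i = 0) \<and> (\<lambda>i. (cmod (x i))\<^sup>2) summable_on S}"

definition ell2_inner :: "'i set \<Rightarrow> ('i \<Rightarrow> complex) \<Rightarrow> ('i \<Rightarrow> complex) \<Rightarrow> complex" where
  "ell2_inner S x y = (\<Sum>\<^sub>\<infinity>i\<in>S. x i * cnj (y i))"

definition ell2_norm :: "'i set \<Rightarrow> ('i \<Rightarrow> complex) \<Rightarrow> real" where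
  "ell2_norm S x = sqrt (\<Sum>\<^sub>\<infinity>i\<in>S. (cmod (x i))\<^sup>2)"

definition ket :: "'i \<Rightarrow> 'i \<Rightarrow> complex" where
  "ket i = (\<lambda>j. if j = i then 1 else 0)"

type_synonym 'i operator = "('i \<Rightarrow> complex) \<Rightarrow> ('i \<Rightarrow> complex)"

text \<open>The extensional function space makes equality of operators coincide with equality of
  their values on \<^term>\<open>ell2 S\<close>.\<close>

definition bounded_ops :: "'i set \<Rightarrow> 'i operator set" where
  "bounded_ops S = {T \<in> ell2 S \<rightarrow>\<^sub>E ell2 S.
     (\<forall>x\<in>ell2 S. \<forall>y\<in>ell2 S. T (\<lambda>i. x i + y i) = (\<lambda>i. T x i + T y i)) \<and>
     (\<forall>c. \<forall>x\<in>ell2 S. T (\<lambda>i. c * x i) = (\<lambda>i. c * T x i)) \<and>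
     (\<exists>C. \<forall>x\<in>ell2 S. ell2_norm S (T x) \<le> C * ell2_norm S x)}"

definition op_id :: "'i set \<Rightarrow> 'i operator" where
  "op_id S = (\<lambda>x\<in>ell2 S. x)"

definition op_add :: "'i set \<Rightarrow> 'i operator \<Rightarrow> 'i operator \<Rightarrow> 'i operator" where
  "op_add S T U = (\<lambda>x\<in>ell2 S. (\<lambda>i. T x i + U x i))"

definition op_scale :: "'i set \<Rightarrow> complex \<Rightarrow> 'i operator \<Rightarrow> 'i operator" where
  "op_scale S c T = (\<lambda>x\<in>ell2 S. (\<lambda>i. c * T x i))"

abbreviation op_mult :: "'i set \<Rightarrow> 'i operator \<Rightarrow> 'i operator \<Rightarrow> 'i operator" where
  "op_mult S T U \<equiv> compose (ell2 S) T U"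

definition commutant :: "'i set \<Rightarrow> 'i operator set \<Rightarrow> 'i operator set" where
  "commutant S A = {T \<in> bounded_ops S. \<forall>U\<in>A. op_mult S T U = op_mult S U T}"

text \<open>The weak operator topology is the initial topology for the matrix coefficients
  \<open>T \<mapsto> \<langle>T x, y\<rangle>\<close>.\<close>

definition wot :: "'i set \<Rightarrow> 'i operator topology" where
  "wot S = pullback_topology (bounded_ops S)
     (\<lambda>T. \<lambda>(x, y)\<in>ell2 S \<times> ell2 S. ell2_inner S (T x) y)
     (product_topology (\<lambda>_. euclidean) (ell2 S \<times> ell2 S))"

definition unital_operator_algebra :: "'i set \<Rightarrow> 'i operator set \<Rightarrow> bool" where
  "unital_operator_algebra S A \<longleftrightarrow>
     A \<subseteq> bounded_ops S \<and> op_id S \<in> A \<and>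
     (\<forall>T\<in>A. \<forall>U\<in>A. op_add S T U \<in> A \<and> op_mult S T U \<in> A) \<and>
     (\<forall>c. \<forall>T\<in>A. op_scale S c T \<in> A)"

definition wot_algebra_generated_by :: "'i set \<Rightarrow> 'i operator set \<Rightarrow> 'i operator set" where
  "wot_algebra_generated_by S X =
     \<Inter>{A. unital_operator_algebra S A \<and> closedin (wot S) A \<and> X \<subseteq> A}"


section \<open>Finite paths\<close>

text \<open>A path is its source vertex together with the list of its edges in the order of
  traversal; the path of length \<open>0\<close> at \<open>x\<close> is \<open>(x, [])\<close>.\<close>

type_synonym ('a, 'b) path = "'a \<times> 'b list"

definition paths :: "('a, 'b) pre_digraph \<Rightarrow> ('a, 'b) path set" where
  "paths G = {(x, es). \<exists>y. pre_digraph.awalk G x es y}"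

definition psource :: "('a, 'b) path \<Rightarrow> 'a" where
  "psource p = fst p"

definition prange :: "('a, 'b) pre_digraph \<Rightarrow> ('a, 'b) path \<Rightarrow> 'a" where
  "prange G p = pre_digraph.awlast G (fst p) (snd p)"

text \<open>Composition is from right to left: \<open>pcomp w v\<close> is the path \<open>wv\<close>, which traverses \<open>v\<close> first.
  The term \<open>pcomp w v\<close> may denote a path even if the ranges and sources do not match (when \<open>w\<close> is
  a vertex), so \<open>wv \<in> G\<^sup>+\<close> is expressed by \<open>composable G w v\<close>.\<close>

definition pcomp :: "('a, 'b) path \<Rightarrow> ('a, 'b) path \<Rightarrow> ('a, 'b) path" where
  "pcomp w v = (fst v, snd v @ snd w)"

definition composable :: "('a, 'b) pre_digraph \<Rightarrow> ('a, 'b) path \<Rightarrow> ('a, 'b) path \<Rightarrow> bool" where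
  "composable G w v \<longleftrightarrow> w \<in> paths G \<and> v \<in> paths G \<and> psource w = prange G v"

definition vertex_path :: "'a \<Rightarrow> ('a, 'b) path" where
  "vertex_path x = (x, [])"

definition arc_path :: "('a, 'b) pre_digraph \<Rightarrow> 'b \<Rightarrow> ('a, 'b) path" where
  "arc_path G e = (tail G e, [e])"


section \<open>Weights\<close>

text \<open>Weights are only constrained on paths; their values elsewhere are never used.\<close>

type_synonym ('a, 'b) weight = "('a, 'b) path \<Rightarrow> ('a, 'b) path \<Rightarrow> real"

definition left_weight :: "('a, 'b) pre_digraph \<Rightarrow> ('a, 'b) weight \<Rightarrow> bool" where
  "left_weight G l \<longleftrightarrow>
     (\<forall>v\<in>paths G. \<forall>w\<in>paths G. l v w \<ge> 0 \<and> (l v w > 0 \<longleftrightarrow> composable G w v)) \<and>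
     (\<forall>v w1 w2. composable G w2 w1 \<and> composable G w1 v \<longrightarrow>
        l v (pcomp w2 w1) = l (pcomp w1 v) w2 * l v w1)"

definition right_weight :: "('a, 'b) pre_digraph \<Rightarrow> ('a, 'b) weight \<Rightarrow> bool" where
  "right_weight G r \<longleftrightarrow>
     (\<forall>v\<in>paths G. \<forall>u\<in>paths G. r v u \<ge> 0 \<and> (r v u > 0 \<longleftrightarrow> composable G v u)) \<and>
     (\<forall>v u1 u2. composable G v u1 \<and> composable G u1 u2 \<longrightarrow>
        r v (pcomp u1 u2) = r (pcomp v u1) u2 * r v u1)"

definition weight_sup :: "('a, 'b) pre_digraph \<Rightarrow> ('a, 'b) weight \<Rightarrow> ('a, 'b) path \<Rightarrow> ennreal" where
  "weight_sup G l w = (SUP v\<in>paths G. ennreal (l v w))"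

definition left_bounded :: "('a, 'b) pre_digraph \<Rightarrow> ('a, 'b) weight \<Rightarrow> bool" where
  "left_bounded G l \<longleftrightarrow> (\<forall>w\<in>paths G. weight_sup G l w < \<infinity>)"

definition right_companion ::
  "('a, 'b) pre_digraph \<Rightarrow> ('a, 'b) weight \<Rightarrow> ('a, 'b) weight \<Rightarrow> bool" where
  "right_companion G l r \<longleftrightarrow> right_weight G r \<and>
     (\<forall>v w u. composable G w v \<and> composable G v u \<longrightarrow>
        r (pcomp w v) u * l v w = l (pcomp v u) w * r v u)"

definition canonical_right_companion ::
  "('a, 'b) pre_digraph \<Rightarrow> ('a, 'b) weight \<Rightarrow> ('a, 'b) weight \<Rightarrow> bool" where
  "canonical_right_companion G l r \<longleftrightarrow> right_companion G l r \<and>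
     (\<forall>e\<in>arcs G. r (vertex_path (head G e)) (arc_path G e)
                  = l (vertex_path (tail G e)) (arc_path G e))"

definition bounded_paths ::
  "('a, 'b) pre_digraph \<Rightarrow> ('a, 'b) weight \<Rightarrow> ('a, 'b) path set" where
  "bounded_paths G r = {u \<in> paths G. weight_sup G r u < \<infinity>}"


section \<open>Weighted shifts and the algebra they generate\<close>

definition is_weighted_shift :: "('a, 'b) pre_digraph \<Rightarrow> ('a, 'b) weight \<Rightarrow> ('a, 'b) path \<Rightarrow>
    ('a, 'b) path operator \<Rightarrow> bool" where
  "is_weighted_shift G l w T \<longleftrightarrow> T \<in> bounded_ops (paths G) \<and>
     (\<forall>v\<in>paths G. T (ket v) =
        (if composable G w v then (\<lambda>p. complex_of_real (l v w) * ket (pcomp w v) p) else (\<lambda>p. 0)))"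

text \<open>For a left weight \<open>l\<close> and a path \<open>w\<close> with \<open>weight_sup G l w < \<infinity>\<close> this operator exists and
  is unique; see \<open>ex1_weighted_shift\<close> below.\<close>

definition weighted_shift :: "('a, 'b) pre_digraph \<Rightarrow> ('a, 'b) weight \<Rightarrow> ('a, 'b) path \<Rightarrow>
    ('a, 'b) path operator" where
  "weighted_shift G l w = (THE T. is_weighted_shift G l w T)"

definition left_algebra :: "('a, 'b) pre_digraph \<Rightarrow> ('a, 'b) weight \<Rightarrow>
    ('a, 'b) path operator set" where
  "left_algebra G l = wot_algebra_generated_by (paths G) (weighted_shift G l ` bounded_paths G l)"


section \<open>Existence and uniqueness of the weighted shifts\<close>

lemma topspace_wot: "topspace (wot S) = bounded_ops S"
  by (auto simp: wot_def topspace_pullback_topology)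

lemma bounded_ops_add:
  assumes "T \<in> bounded_ops S" "x \<in> ell2 S" "y \<in> ell2 S"
  shows "T (\<lambda>i. x i + y i) = (\<lambda>i. T x i + T y i)"
  using assms by (simp add: bounded_ops_def)

lemma bounded_ops_scale:
  assumes "T \<in> bounded_ops S" "x \<in> ell2 S"
  shows "T (\<lambda>i. c * x i) = (\<lambda>i. c * T x i)"
  using assms by (simp add: bounded_ops_def)

lemma ell2_norm_nonneg: "ell2_norm S x \<ge> 0"
  by (simp add: ell2_norm_def infsum_nonneg)

lemma ell2_norm_coord:
  assumes "x \<in> ell2 S" shows "cmod (x i) \<le> ell2_norm S x"
proof (cases "i \<in> S")
  case True
  have "(\<Sum>j\<in>{i}. (cmod (x j))\<^sup>2) \<le> (\<Sum>\<^sub>\<infinity>j\<in>S. (cmod (x j))\<^sup>2)"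
    using assms True by (intro finite_sum_le_infsum) (auto simp: ell2_def)
  then show ?thesis by (simp add: ell2_norm_def real_le_rsqrt)
next
  case False
  then show ?thesis using assms by (simp add: ell2_def ell2_norm_nonneg)
qed

lemma ell2_restrict:
  assumes "x \<in> ell2 S" shows "(\<lambda>i. if i \<in> F then x i else 0) \<in> ell2 S"
proof -
  have "(\<lambda>i. (cmod (if i \<in> F then x i else 0))\<^sup>2) summable_on S"
    by (rule summable_on_comparison_test[of "\<lambda>i. (cmod (x i))\<^sup>2"])
       (use assms in \<open>auto simp: ell2_def\<close>)
  then show ?thesis using assms by (auto simp: ell2_def)
qed

lemma ket_in_ell2: "i \<in> S \<Longrightarrow> ket i \<in> ell2 S"
proof -
  assume "i \<in> S"
  moreover have "(\<lambda>j. (cmod (ket i j))\<^sup>2) summable_on S"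
    by (subst summable_on_cong_neutral[where S = "S \<inter> {i}" and g = "\<lambda>j. (cmod (ket i j))\<^sup>2", symmetric])
       (auto simp: ket_def)
  ultimately show ?thesis by (auto simp: ell2_def ket_def)
qed

lemma bounded_ops_finite_support:
  assumes T: "T \<in> bounded_ops S" and U: "U \<in> bounded_ops S"
    and eq: "\<And>i. i \<in> S \<Longrightarrow> T (ket i) = U (ket i)"
    and x: "x \<in> ell2 S" and F: "finite F"
  shows "T (\<lambda>i. if i \<in> F then x i else 0) = U (\<lambda>i. if i \<in> F then x i else 0)"
  using F
proof induction
  case empty
  show ?case using bounded_ops_scale[OF T x, of 0] bounded_ops_scale[OF U x, of 0] by simp
next
  case (insert j F)
  let ?y = "\<lambda>i. if i \<in> F then x i else 0"
  show ?case
  proof (cases "j \<in> S")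
    case False
    then have "(\<lambda>i. if i \<in> insert j F then x i else 0) = ?y"
      using x by (auto simp: ell2_def)
    then show ?thesis using insert.IH by simp
  next
    case True
    have k: "ket j \<in> ell2 S" using True by (rule ket_in_ell2)
    have y: "?y \<in> ell2 S" using x by (rule ell2_restrict)
    have ck: "(\<lambda>i. x j * ket j i) \<in> ell2 S"
    proof -
      have "(\<lambda>i. x j * ket j i) = (\<lambda>i. if i \<in> {j} then x i else 0)"
        by (auto simp: ket_def)
      then show ?thesis using ell2_restrict[OF x, of "{j}"] by simp
    qed
    have e: "(\<lambda>i. if i \<in> insert j F then x i else 0) = (\<lambda>i. x j * ket j i + ?y i)"
      using insert.hyps by (auto simp: ket_def)
    have "R (\<lambda>i. x j * ket j i + ?y i) = (\<lambda>i. x j * R (ket j) i + R ?y i)"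
      if R: "R \<in> bounded_ops S" for R
    proof -
      have "R (\<lambda>i. x j * ket j i + ?y i) = (\<lambda>i. R (\<lambda>i. x j * ket j i) i + R ?y i)"
        by (rule bounded_ops_add[OF R ck y])
      moreover have "R (\<lambda>i. x j * ket j i) = (\<lambda>i. x j * R (ket j) i)"
        by (rule bounded_ops_scale[OF R k])
      ultimately show ?thesis by simp
    qed
    from this[OF T] this[OF U] show ?thesis
      unfolding e using eq[OF True] insert.IH by simp
  qed
qed

lemma ell2_tail:
  assumes x: "x \<in> ell2 S" and e: "e > 0"
  obtains F where "finite F" "ell2_norm S (\<lambda>i. if i \<in> - F then x i else 0) \<le> e"
proof -
  let ?f = "\<lambda>i. (cmod (x i))\<^sup>2"
  have s: "?f summable_on S" using x by (simp add: ell2_def)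
  obtain F where F: "finite F" "F \<subseteq> S" and d: "dist (sum ?f F) (infsum ?f S) \<le> e\<^sup>2"
    using infsum_finite_approximation[OF s, of "e\<^sup>2"] e by auto
  have "(\<Sum>\<^sub>\<infinity>i\<in>S. (cmod (if i \<in> - F then x i else 0))\<^sup>2) = infsum ?f (S - F)"
    by (rule infsum_cong_neutral) auto
  also have "\<dots> = infsum ?f S - sum ?f F"
    using infsum_Diff[OF s _ F(2)] F by simp
  also have "\<dots> \<le> e\<^sup>2" using d by (simp add: dist_real_def)
  finally have "ell2_norm S (\<lambda>i. if i \<in> - F then x i else 0) \<le> e"
    unfolding ell2_norm_def using e by (intro real_le_lsqrt) (auto simp: infsum_nonneg)
  then show ?thesis using that F by blast
qed

lemma bounded_ops_eqI:
  assumes T: "T \<in> bounded_ops S" and U: "U \<in> bounded_ops S"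
    and eq: "\<And>i. i \<in> S \<Longrightarrow> T (ket i) = U (ket i)"
  shows "T = U"
proof
  fix x
  obtain C where C: "\<forall>x\<in>ell2 S. ell2_norm S (T x) \<le> C * ell2_norm S x"
    using T unfolding bounded_ops_def by blast
  obtain D where D: "\<forall>x\<in>ell2 S. ell2_norm S (U x) \<le> D * ell2_norm S x"
    using U unfolding bounded_ops_def by blast
  define M where "M = \<bar>C\<bar> + \<bar>D\<bar> + 1"
  show "T x = U x"
  proof (cases "x \<in> ell2 S")
    case False
    then show ?thesis using T U by (auto simp: bounded_ops_def PiE_def extensional_def)
  next
    case x: True
    show ?thesis
    proof
      fix i
      have "cmod (T x i - U x i) \<le> e" if e: "e > 0" for e
      proof -
        have M: "M > 0" by (simp add: M_def)
        obtain F where F: "finite F"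
          "ell2_norm S (\<lambda>i. if i \<in> - F then x i else 0) \<le> e / M"
          using ell2_tail[OF x, of "e / M"] e M by auto
        let ?a = "\<lambda>i. if i \<in> F then x i else 0" and ?b = "\<lambda>i. if i \<in> - F then x i else 0"
        have a: "?a \<in> ell2 S" and b: "?b \<in> ell2 S" using x by (rule ell2_restrict)+
        have xab: "x = (\<lambda>i. ?a i + ?b i)" by auto
        have "R (\<lambda>i. ?a i + ?b i) = (\<lambda>i. R ?a i + R ?b i)" if "R \<in> bounded_ops S" for R
          by (rule bounded_ops_add[OF that a b])
        from this[OF T] this[OF U]
        have R: "T x = (\<lambda>i. T ?a i + T ?b i)" "U x = (\<lambda>i. U ?a i + U ?b i)"
          using xab by simp_all
        have "T ?a = U ?a" by (rule bounded_ops_finite_support[OF T U eq x F(1)])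
        then have "T x i - U x i = T ?b i - U ?b i" using R by simp
        then have "cmod (T x i - U x i) \<le> cmod (T ?b i) + cmod (U ?b i)"
          by (simp add: norm_triangle_ineq4)
        also have "\<dots> \<le> ell2_norm S (T ?b) + ell2_norm S (U ?b)"
          using T U b by (intro add_mono ell2_norm_coord) (auto simp: bounded_ops_def)
        also have "\<dots> \<le> C * ell2_norm S ?b + D * ell2_norm S ?b"
          using C D b by (intro add_mono) auto
        also have "\<dots> = (C + D) * ell2_norm S ?b" by (simp add: algebra_simps)
        also have "\<dots> \<le> M * ell2_norm S ?b"
          by (rule mult_right_mono) (auto simp: M_def ell2_norm_nonneg)
        also have "\<dots> \<le> M * (e / M)" using F(2) M by (intro mult_left_mono) auto
        also have "\<dots> = e" using M by simp
        finally show ?thesis .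
      qed
      then have "cmod (T x i - U x i) \<le> 0" by (rule field_le_epsilon[of _ 0, simplified])
      then show "T x i = U x i" by simp
    qed
  qed
qed

lemma inj_pcomp:
  assumes "pcomp w v = pcomp w v'" shows "v = v'"
  using assms by (auto simp: pcomp_def prod_eq_iff)

lemma pcomp_in_paths:
  assumes "fin_digraph G" "composable G w v" shows "pcomp w v \<in> paths G"
proof -
  interpret fin_digraph G by fact
  from assms(2) show ?thesis
    by (auto simp: composable_def paths_def pcomp_def psource_def prange_def intro: awalk_appendI)
qed

lemma ex_weighted_shift:
  assumes G: "fin_digraph G" and l: "left_weight G l" and w: "w \<in> bounded_paths G l"
  shows "\<exists>T. is_weighted_shift G l w T"
proof -
  let ?S = "paths G"
  define C where "C = enn2real (weight_sup G l w)"
  have wG: "w \<in> ?S" and fin: "weight_sup G l w < \<infinity>" using w by (auto simp: bounded_paths_def)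
  have lC: "0 \<le> l v w" "l v w \<le> C" if v: "v \<in> ?S" for v
  proof -
    show "0 \<le> l v w" using l v wG by (auto simp: left_weight_def)
    have "ennreal (l v w) \<le> weight_sup G l w"
      unfolding weight_sup_def using v by (rule SUP_upper)
    then show "l v w \<le> C" using fin unfolding C_def
      by (metis enn2real_nonneg ennreal_enn2real ennreal_le_iff infinity_ennreal_def)
  qed
  have C0: "C \<ge> 0" by (simp add: C_def)
  define D where "D = {v. composable G w v}"
  have D: "D \<subseteq> ?S" by (auto simp: D_def composable_def)
  have im: "pcomp w ` D \<subseteq> ?S" using pcomp_in_paths[OF G] unfolding D_def by blast
  have inj: "inj_on (pcomp w) D" by (auto intro!: inj_onI dest: inj_pcomp)
  define W where "W x p = (if p \<in> pcomp w ` D then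
      complex_of_real (l (the_inv_into D (pcomp w) p) w) * x (the_inv_into D (pcomp w) p) else 0)"
    for x and p
  have Wc: "W x (pcomp w v) = complex_of_real (l v w) * x v" if "v \<in> D" for x v
    using that inj by (simp add: W_def the_inv_into_f_f)
  have Wn: "W x p = 0" if "p \<notin> pcomp w ` D" for x p using that by (simp add: W_def)
  have cm: "(cmod (W x (pcomp w v)))\<^sup>2 \<le> C\<^sup>2 * (cmod (x v))\<^sup>2" if "v \<in> D" for x v
  proof -
    have "v \<in> ?S" using that D by auto
    then show ?thesis using lC[of v] that
      by (simp add: Wc norm_mult power_mult_distrib mult_right_mono power_mono)
  qed
  have sumD: "(\<lambda>v. (cmod (W x (pcomp w v)))\<^sup>2) summable_on D" and bd:
      "(\<Sum>\<^sub>\<infinity>v\<in>D. (cmod (W x (pcomp w v)))\<^sup>2) \<le> C\<^sup>2 * (\<Sum>\<^sub>\<infinity>v\<in>?S. (cmod (x v))\<^sup>2)"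
    if x: "x \<in> ell2 ?S" for x
  proof -
    have s: "(\<lambda>v. (cmod (x v))\<^sup>2) summable_on ?S" using x by (simp add: ell2_def)
    then have s': "(\<lambda>v. C\<^sup>2 * (cmod (x v))\<^sup>2) summable_on ?S" by (rule summable_on_cmult_right)
    then have sD: "(\<lambda>v. C\<^sup>2 * (cmod (x v))\<^sup>2) summable_on D"
      using D by (rule summable_on_subset_banach)
    show 1: "(\<lambda>v. (cmod (W x (pcomp w v)))\<^sup>2) summable_on D"
      by (rule summable_on_comparison_test[OF sD]) (auto intro: cm)
    have "(\<Sum>\<^sub>\<infinity>v\<in>D. (cmod (W x (pcomp w v)))\<^sup>2) \<le> (\<Sum>\<^sub>\<infinity>v\<in>?S. C\<^sup>2 * (cmod (x v))\<^sup>2)"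
      by (rule infsum_mono_neutral[OF 1 s']) (use D cm in auto)
    then show "(\<Sum>\<^sub>\<infinity>v\<in>D. (cmod (W x (pcomp w v)))\<^sup>2) \<le> C\<^sup>2 * (\<Sum>\<^sub>\<infinity>v\<in>?S. (cmod (x v))\<^sup>2)"
      by (simp add: infsum_cmult_right')
  qed
  have Wl2: "W x \<in> ell2 ?S" if x: "x \<in> ell2 ?S" for x
  proof -
    have "(\<lambda>p. (cmod (W x p))\<^sup>2) summable_on pcomp w ` D"
      using sumD[OF x] summable_on_reindex[OF inj, of "\<lambda>p. (cmod (W x p))\<^sup>2"] by (simp add: o_def)
    then have "(\<lambda>p. (cmod (W x p))\<^sup>2) summable_on ?S"
      by (subst summable_on_cong_neutral[where T = "pcomp w ` D"
            and g = "\<lambda>p. (cmod (W x p))\<^sup>2"]) (use im Wn in auto)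
    moreover have "W x p = 0" if "p \<notin> ?S" for p using that im by (intro Wn) blast
    ultimately show ?thesis unfolding ell2_def by blast
  qed
  have Wbd: "ell2_norm ?S (W x) \<le> C * ell2_norm ?S x" if x: "x \<in> ell2 ?S" for x
  proof -
    have "(\<Sum>\<^sub>\<infinity>p\<in>?S. (cmod (W x p))\<^sup>2) = (\<Sum>\<^sub>\<infinity>p\<in>pcomp w ` D. (cmod (W x p))\<^sup>2)"
      by (rule infsum_cong_neutral) (use im Wn in auto)
    also have "\<dots> = (\<Sum>\<^sub>\<infinity>v\<in>D. (cmod (W x (pcomp w v)))\<^sup>2)"
      using infsum_reindex[OF inj, of "\<lambda>p. (cmod (W x p))\<^sup>2"] by (simp add: o_def)
    finally have "ell2_norm ?S (W x) \<le> sqrt (C\<^sup>2 * (\<Sum>\<^sub>\<infinity>v\<in>?S. (cmod (x v))\<^sup>2))"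
      unfolding ell2_norm_def using bd[OF x] by simp
    then show ?thesis using C0 by (simp add: ell2_norm_def real_sqrt_mult)
  qed
  have add2: "(\<lambda>i. x i + y i) \<in> ell2 ?S" if "x \<in> ell2 ?S" "y \<in> ell2 ?S" for x y
  proof -
    have "(\<lambda>i. 2 * (cmod (x i))\<^sup>2 + 2 * (cmod (y i))\<^sup>2) summable_on ?S"
      using that by (intro summable_on_add summable_on_cmult_right) (auto simp: ell2_def)
    then have "(\<lambda>i. (cmod (x i + y i))\<^sup>2) summable_on ?S"
    proof (rule summable_on_comparison_test)
      fix i
      have "(cmod (x i + y i))\<^sup>2 \<le> (cmod (x i) + cmod (y i))\<^sup>2"
        by (intro power_mono norm_triangle_ineq) auto
      also have "\<dots> \<le> 2 * (cmod (x i))\<^sup>2 + 2 * (cmod (y i))\<^sup>2"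
        using sum_squares_bound[of "cmod (x i)" "cmod (y i)"] by (simp add: power2_sum)
      finally show "(cmod (x i + y i))\<^sup>2 \<le> 2 * (cmod (x i))\<^sup>2 + 2 * (cmod (y i))\<^sup>2" .
    qed auto
    then show ?thesis using that by (auto simp: ell2_def)
  qed
  have scl: "(\<lambda>i. c * x i) \<in> ell2 ?S" if "x \<in> ell2 ?S" for x c
    using that by (auto simp: ell2_def norm_mult power_mult_distrib intro!: summable_on_cmult_right)
  have "(\<lambda>x\<in>ell2 ?S. W x) \<in> bounded_ops ?S"
    unfolding bounded_ops_def
  proof (intro CollectI conjI ballI allI)
    show "(\<lambda>x\<in>ell2 ?S. W x) \<in> ell2 ?S \<rightarrow>\<^sub>E ell2 ?S" using Wl2 by auto
    show "\<exists>C. \<forall>x\<in>ell2 ?S. ell2_norm ?S ((\<lambda>x\<in>ell2 ?S. W x) x) \<le> C * ell2_norm ?S x"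
      using Wbd by auto
  qed (simp_all add: add2 scl, auto simp: W_def fun_eq_iff algebra_simps)
  moreover have "W (ket v) =
      (if composable G w v then (\<lambda>p. complex_of_real (l v w) * ket (pcomp w v) p) else (\<lambda>p. 0))" for v
  proof
    fix p
    show "W (ket v) p = (if composable G w v
        then (\<lambda>p. complex_of_real (l v w) * ket (pcomp w v) p) else (\<lambda>p. 0)) p"
    proof (cases "p \<in> pcomp w ` D")
      case True
      then obtain v' where v': "v' \<in> D" "p = pcomp w v'" by auto
      then show ?thesis using inj_pcomp[of w v v'] by (auto simp: Wc ket_def D_def)
    next
      case False
      then show ?thesis by (auto simp: Wn ket_def D_def)
    qed
  qed
  ultimately have "is_weighted_shift G l w (\<lambda>x\<in>ell2 ?S. W x)"
    by (simp add: is_weighted_shift_def ket_in_ell2)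
  then show ?thesis by (intro exI[where x = "\<lambda>x\<in>ell2 ?S. W x"])
qed

lemma ex1_weighted_shift:
  assumes "fin_digraph G" "left_weight G l" "w \<in> bounded_paths G l"
  shows "\<exists>!T. is_weighted_shift G l w T"
proof (rule ex_ex1I)
  show "\<exists>T. is_weighted_shift G l w T" using assms by (rule ex_weighted_shift)
  show "T = U" if "is_weighted_shift G l w T" "is_weighted_shift G l w U" for T U
    using that by (intro bounded_ops_eqI[of T "paths G" U]) (auto simp: is_weighted_shift_def)
qed

lemma weighted_shift_is_weighted_shift:
  assumes "fin_digraph G" "left_weight G l" "w \<in> bounded_paths G l"
  shows "is_weighted_shift G l w (weighted_shift G l w)"
  unfolding weighted_shift_def using ex1_weighted_shift[OF assms] by (rule theI')

end

theory Submission
  imports Defs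
begin

text \<open>The right shifts \<open>R\<^sub>u\<close> with \<open>u \<in> G\<^sup>+\<^sub>\<rho>\<close> commute with every \<open>L\<^sub>w\<close>, so they lie in the commutant,
  and an operator \<open>T\<close> of the double commutant commutes with them. The hypothesis on \<open>v\<close> and
  \<open>u\<^sub>v\<close> then allows \<open>T \<xi>\<^sub>v\<close> to be recovered from \<open>T \<xi>\<^sub>x\<close> for the vertex \<open>x = r(v)\<close>: the matrix of \<open>T\<close>
  is that of the formal series \<open>\<Sum>\<^sub>w a\<^sub>w L\<^sub>w\<close>, where \<open>a\<^sub>w\<close> is the \<open>w\<close>-coordinate of \<open>T \<xi>\<^sub>x\<close>, with \<open>x = s(w)\<close>,
  divided by \<open>\<lambda>(x, w)\<close>. Its Cesaro sums are finite combinations of the \<open>L\<^sub>w\<close>, because \<open>G\<close> is finite;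
  they are bounded by the norm of \<open>T\<close> and converge to \<open>T\<close> entrywise, hence in the weak operator
  topology.\<close>


section \<open>Square-summable functions and bounded operators\<close>

lemma ell2_zero: "(\<lambda>i. 0) \<in> ell2 S"
  by (simp add: ell2_def)

lemma ell2_norm_power2: "(ell2_norm S x)\<^sup>2 = (\<Sum>\<^sub>\<infinity>i\<in>S. (cmod (x i))\<^sup>2)"
  by (simp add: ell2_norm_def infsum_nonneg)

lemma ell2_scale: "x \<in> ell2 S \<Longrightarrow> (\<lambda>i. c * x i) \<in> ell2 S"
  by (auto simp: ell2_def norm_mult power_mult_distrib intro!: summable_on_cmult_right)

lemma ell2_norm_scale: "ell2_norm S (\<lambda>i. c * x i) = cmod c * ell2_norm S x"
  by (simp add: ell2_norm_def norm_mult power_mult_distrib infsum_cmult_right' real_sqrt_mult)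

lemma cmod_add_power2_le: "(cmod (a + b))\<^sup>2 \<le> 2 * (cmod a)\<^sup>2 + 2 * (cmod b)\<^sup>2"
proof -
  have "(cmod (a + b))\<^sup>2 \<le> (cmod a + cmod b)\<^sup>2"
    by (intro power_mono norm_triangle_ineq) auto
  also have "\<dots> \<le> 2 * (cmod a)\<^sup>2 + 2 * (cmod b)\<^sup>2"
    using sum_squares_bound[of "cmod a" "cmod b"] by (simp add: power2_sum)
  finally show ?thesis .
qed

text \<open>The norm estimate only has to show that a sum of bounded operators is bounded, so the
  crude constant that \<open>cmod_add_power2_le\<close> yields is enough.\<close>

lemma
  assumes x: "x \<in> ell2 S" and y: "y \<in> ell2 S"
  shows ell2_add: "(\<lambda>i. x i + y i) \<in> ell2 S"
    and ell2_norm_add_le: "ell2_norm S (\<lambda>i. x i + y i) \<le> 2 * (ell2_norm S x + ell2_norm S y)"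
proof -
  let ?f = "\<lambda>i. 2 * (cmod (x i))\<^sup>2 + 2 * (cmod (y i))\<^sup>2"
  have sx: "(\<lambda>i. 2 * (cmod (x i))\<^sup>2) summable_on S" and sy: "(\<lambda>i. 2 * (cmod (y i))\<^sup>2) summable_on S"
    using x y by (auto simp: ell2_def intro!: summable_on_cmult_right)
  have f: "?f summable_on S" by (rule summable_on_add[OF sx sy])
  have s: "(\<lambda>i. (cmod (x i + y i))\<^sup>2) summable_on S"
    by (rule summable_on_comparison_test[OF f]) (auto intro: cmod_add_power2_le)
  then show "(\<lambda>i. x i + y i) \<in> ell2 S" using x y by (auto simp: ell2_def)
  have "(\<Sum>\<^sub>\<infinity>i\<in>S. (cmod (x i + y i))\<^sup>2) \<le> (\<Sum>\<^sub>\<infinity>i\<in>S. ?f i)"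
    by (rule infsum_mono[OF s f]) (rule cmod_add_power2_le)
  also have "\<dots> = 2 * (ell2_norm S x)\<^sup>2 + 2 * (ell2_norm S y)\<^sup>2"
    by (simp add: infsum_add[OF sx sy] infsum_cmult_right' ell2_norm_power2)
  also have "\<dots> \<le> (2 * (ell2_norm S x + ell2_norm S y))\<^sup>2"
    by (simp add: power2_eq_square algebra_simps ell2_norm_nonneg)
  finally have "sqrt (\<Sum>\<^sub>\<infinity>i\<in>S. (cmod (x i + y i))\<^sup>2) \<le> 2 * (ell2_norm S x + ell2_norm S y)"
    by (intro real_le_lsqrt) (auto simp: ell2_norm_nonneg infsum_nonneg)
  then show "ell2_norm S (\<lambda>i. x i + y i) \<le> 2 * (ell2_norm S x + ell2_norm S y)"
    by (simp add: ell2_norm_def)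
qed

text \<open>Absolute summability comes from the inequality between arithmetic and geometric means.
  The bound is then checked on finite partial sums, where it is the Cauchy-Schwarz inequality for
  \<open>L2_set\<close>.\<close>

lemma
  assumes x: "x \<in> ell2 S" and y: "y \<in> ell2 S"
  shows ell2_inner_summable: "(\<lambda>i. x i * cnj (y i)) summable_on S"
    and ell2_cauchy_schwarz: "cmod (ell2_inner S x y) \<le> ell2_norm S x * ell2_norm S y"
proof -
  have a: "(\<lambda>i. norm (x i * cnj (y i))) summable_on S"
  proof (rule summable_on_comparison_test)
    show "(\<lambda>i. (cmod (x i))\<^sup>2 + (cmod (y i))\<^sup>2) summable_on S"
      using x y by (auto simp: ell2_def intro!: summable_on_add)
    show "norm (x i * cnj (y i)) \<le> (cmod (x i))\<^sup>2 + (cmod (y i))\<^sup>2" for i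
    proof -
      have "2 * (cmod (x i) * cmod (y i)) \<le> (cmod (x i))\<^sup>2 + (cmod (y i))\<^sup>2"
        using sum_squares_bound[of "cmod (x i)" "cmod (y i)"] by simp
      moreover have "0 \<le> cmod (x i) * cmod (y i)" by simp
      ultimately show ?thesis unfolding norm_mult complex_mod_cnj by linarith
    qed
  qed auto
  then show "(\<lambda>i. x i * cnj (y i)) summable_on S" by (rule abs_summable_summable)
  have "cmod (ell2_inner S x y) \<le> (\<Sum>\<^sub>\<infinity>i\<in>S. norm (x i * cnj (y i)))"
    unfolding ell2_inner_def by (rule norm_infsum_bound[OF a])
  also have "\<dots> \<le> ell2_norm S x * ell2_norm S y"
  proof (rule infsum_le_finite_sums[OF a])
    fix F assume F: "finite F" "F \<subseteq> S"
    have le: "L2_set (\<lambda>i. cmod (z i)) F \<le> ell2_norm S z" if "z \<in> ell2 S" for z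
      unfolding L2_set_def ell2_norm_def
      using that F by (intro real_sqrt_le_mono finite_sum_le_infsum) (auto simp: ell2_def)
    have "(\<Sum>i\<in>F. norm (x i * cnj (y i))) \<le> L2_set (\<lambda>i. cmod (x i)) F * L2_set (\<lambda>i. cmod (y i)) F"
      using L2_set_mult_ineq[of "\<lambda>i. cmod (x i)" "\<lambda>i. cmod (y i)" F] by (simp add: norm_mult)
    also have "\<dots> \<le> ell2_norm S x * ell2_norm S y"
      by (intro mult_mono le x y) (auto simp: ell2_norm_nonneg L2_set_nonneg)
    finally show "(\<Sum>i\<in>F. norm (x i * cnj (y i))) \<le> ell2_norm S x * ell2_norm S y" .
  qed
  finally show "cmod (ell2_inner S x y) \<le> ell2_norm S x * ell2_norm S y" .
qed

lemma ell2_inner_add_left: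
  assumes "x \<in> ell2 S" "x' \<in> ell2 S" "y \<in> ell2 S"
  shows "ell2_inner S (\<lambda>i. x i + x' i) y = ell2_inner S x y + ell2_inner S x' y"
  using infsum_add[OF ell2_inner_summable[OF assms(1,3)] ell2_inner_summable[OF assms(2,3)]]
  by (simp add: ell2_inner_def distrib_right)

lemma ell2_inner_add_right:
  assumes "x \<in> ell2 S" "y \<in> ell2 S" "y' \<in> ell2 S"
  shows "ell2_inner S x (\<lambda>i. y i + y' i) = ell2_inner S x y + ell2_inner S x y'"
  using infsum_add[OF ell2_inner_summable[OF assms(1,2)] ell2_inner_summable[OF assms(1,3)]]
  by (simp add: ell2_inner_def distrib_left)

lemma ell2_inner_ket: "p \<in> S \<Longrightarrow> ell2_inner S x (ket p) = x p"
proof -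
  assume "p \<in> S"
  then have "ell2_inner S x (ket p) = (\<Sum>\<^sub>\<infinity>i\<in>{p}. x i * cnj (ket p i))"
    unfolding ell2_inner_def by (intro infsum_cong_neutral) (auto simp: ket_def)
  then show ?thesis by (simp add: ket_def)
qed

section \<open>Coordinate projections and tail estimates\<close>

definition cutoff :: "'i set \<Rightarrow> ('i \<Rightarrow> complex) \<Rightarrow> 'i \<Rightarrow> complex" where
  "cutoff F x = (\<lambda>i. if i \<in> F then x i else 0)"

lemma cutoff_in_ell2: "x \<in> ell2 S \<Longrightarrow> cutoff F x \<in> ell2 S"
  unfolding cutoff_def by (rule ell2_restrict)

lemma cutoff_split: "(\<lambda>i. cutoff F x i + cutoff (- F) x i) = x"
  by (auto simp: cutoff_def)

lemma ell2_norm_cutoff_mono: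
  assumes "x \<in> ell2 S" "F \<subseteq> F'"
  shows "ell2_norm S (cutoff F x) \<le> ell2_norm S (cutoff F' x)"
  unfolding ell2_norm_def using assms(2) cutoff_in_ell2[OF assms(1)]
  by (intro real_sqrt_le_mono infsum_mono) (auto simp: ell2_def cutoff_def)

lemma ell2_norm_cutoff_le: "x \<in> ell2 S \<Longrightarrow> ell2_norm S (cutoff F x) \<le> ell2_norm S x"
  using ell2_norm_cutoff_mono[of x S F UNIV] by (simp add: cutoff_def)

lemma ell2_norm_cutoff_power2:
  assumes "finite F" "F \<subseteq> S"
  shows "(ell2_norm S (cutoff F x))\<^sup>2 = (\<Sum>i\<in>F. (cmod (x i))\<^sup>2)"
proof -
  have "(\<Sum>\<^sub>\<infinity>i\<in>S. (cmod (cutoff F x i))\<^sup>2) = (\<Sum>\<^sub>\<infinity>i\<in>F. (cmod (x i))\<^sup>2)"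
    by (rule infsum_cong_neutral) (use assms in \<open>auto simp: cutoff_def\<close>)
  then show ?thesis using assms by (simp add: ell2_norm_power2)
qed

lemma ell2_inner_cutoff_right:
  assumes "finite F" "F \<subseteq> S"
  shows "ell2_inner S x (cutoff F y) = (\<Sum>i\<in>F. x i * cnj (y i))"
proof -
  have "(\<Sum>\<^sub>\<infinity>i\<in>S. x i * cnj (cutoff F y i)) = (\<Sum>\<^sub>\<infinity>i\<in>F. x i * cnj (y i))"
    by (rule infsum_cong_neutral) (use assms in \<open>auto simp: cutoff_def\<close>)
  then show ?thesis using assms by (simp add: ell2_inner_def)
qed

text \<open>One finite set serves both arguments of a form. Cutting it down to \<open>S\<close>
  costs nothing, since the vectors vanish outside \<open>S\<close>.\<close>

lemma ell2_tail_pair: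
  assumes x: "x \<in> ell2 S" and y: "y \<in> ell2 S" and e: "e > 0"
  obtains F where "finite F" "F \<subseteq> S"
    "ell2_norm S (cutoff (- F) x) \<le> e" "ell2_norm S (cutoff (- F) y) \<le> e"
proof -
  obtain A where A: "finite A" "ell2_norm S (cutoff (- A) x) \<le> e"
    using ell2_tail[OF x e] unfolding cutoff_def by blast
  obtain B where B: "finite B" "ell2_norm S (cutoff (- B) y) \<le> e"
    using ell2_tail[OF y e] unfolding cutoff_def by blast
  let ?F = "(A \<union> B) \<inter> S"
  have eq: "cutoff (- ?F) z = cutoff (- (A \<union> B)) z" if "z \<in> ell2 S" for z
    using that by (auto simp: cutoff_def ell2_def)
  have "ell2_norm S (cutoff (- ?F) x) \<le> e" "ell2_norm S (cutoff (- ?F) y) \<le> e"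
    unfolding eq[OF x] eq[OF y]
    using order_trans[OF ell2_norm_cutoff_mono[OF x] A(2)] order_trans[OF ell2_norm_cutoff_mono[OF y] B(2)]
    by auto
  then show thesis using that[of ?F] A(1) B(1) by auto
qed

section \<open>Bounded operators and their algebraic operations\<close>

lemma bounded_ops_in_ell2: "T \<in> bounded_ops S \<Longrightarrow> x \<in> ell2 S \<Longrightarrow> T x \<in> ell2 S"
  by (auto simp: bounded_ops_def)

lemma bounded_ops_zero: "T \<in> bounded_ops S \<Longrightarrow> T (\<lambda>i. 0) = (\<lambda>i. 0)"
  using bounded_ops_scale[of T S "\<lambda>i. 0" 0] by (simp add: ell2_zero)

lemma bounded_ops_bound:
  assumes "T \<in> bounded_ops S"
  obtains C where "C \<ge> 0" "\<And>x. x \<in> ell2 S \<Longrightarrow> ell2_norm S (T x) \<le> C * ell2_norm S x"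
proof -
  obtain C where C: "\<forall>x\<in>ell2 S. ell2_norm S (T x) \<le> C * ell2_norm S x"
    using assms unfolding bounded_ops_def by blast
  have "ell2_norm S (T x) \<le> \<bar>C\<bar> * ell2_norm S x" if "x \<in> ell2 S" for x
    using C that mult_right_mono[of C "\<bar>C\<bar>" "ell2_norm S x"] ell2_norm_nonneg[of S x] by fastforce
  then show thesis using that[of "\<bar>C\<bar>"] by simp
qed

lemma bounded_opsI:
  assumes "\<And>x. x \<in> ell2 S \<Longrightarrow> f x \<in> ell2 S"
    and "\<And>x y. x \<in> ell2 S \<Longrightarrow> y \<in> ell2 S \<Longrightarrow> f (\<lambda>i. x i + y i) = (\<lambda>i. f x i + f y i)"
    and "\<And>c x. x \<in> ell2 S \<Longrightarrow> f (\<lambda>i. c * x i) = (\<lambda>i. c * f x i)"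
    and "\<And>x. x \<in> ell2 S \<Longrightarrow> ell2_norm S (f x) \<le> C * ell2_norm S x"
  shows "(\<lambda>x\<in>ell2 S. f x) \<in> bounded_ops S"
  unfolding bounded_ops_def using assms by (auto simp: ell2_add ell2_scale intro!: exI[of _ C])

lemma op_id_in_bounded_ops: "op_id S \<in> bounded_ops S"
  unfolding op_id_def by (rule bounded_opsI[where C = 1]) auto

lemma op_scale_in_bounded_ops:
  assumes T: "T \<in> bounded_ops S" shows "op_scale S c T \<in> bounded_ops S"
proof -
  obtain C where C: "C \<ge> 0" "\<And>x. x \<in> ell2 S \<Longrightarrow> ell2_norm S (T x) \<le> C * ell2_norm S x"
    using bounded_ops_bound[OF T] by blast
  have "ell2_norm S (\<lambda>i. c * T x i) \<le> (cmod c * C) * ell2_norm S x" if "x \<in> ell2 S" for x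
    using C(2)[OF that] by (simp add: ell2_norm_scale mult_left_mono mult.assoc)
  then show ?thesis unfolding op_scale_def
    using T by (intro bounded_opsI[where C = "cmod c * C"])
      (auto simp: bounded_ops_in_ell2 ell2_scale bounded_ops_add bounded_ops_scale algebra_simps)
qed

lemma op_add_in_bounded_ops:
  assumes T: "T \<in> bounded_ops S" and U: "U \<in> bounded_ops S"
  shows "op_add S T U \<in> bounded_ops S"
proof -
  obtain C where C: "C \<ge> 0" "\<And>x. x \<in> ell2 S \<Longrightarrow> ell2_norm S (T x) \<le> C * ell2_norm S x"
    using bounded_ops_bound[OF T] by blast
  obtain D where D: "D \<ge> 0" "\<And>x. x \<in> ell2 S \<Longrightarrow> ell2_norm S (U x) \<le> D * ell2_norm S x"
    using bounded_ops_bound[OF U] by blast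
  have "ell2_norm S (\<lambda>i. T x i + U x i) \<le> (2 * (C + D)) * ell2_norm S x" if x: "x \<in> ell2 S" for x
    using ell2_norm_add_le[OF bounded_ops_in_ell2[OF T x] bounded_ops_in_ell2[OF U x]]
      C(2)[OF x] D(2)[OF x] by (simp add: algebra_simps)
  then show ?thesis unfolding op_add_def
    using T U by (intro bounded_opsI[where C = "2 * (C + D)"])
      (auto simp: bounded_ops_in_ell2 ell2_add bounded_ops_add bounded_ops_scale algebra_simps)
qed

lemma op_mult_in_bounded_ops:
  assumes T: "T \<in> bounded_ops S" and U: "U \<in> bounded_ops S"
  shows "op_mult S T U \<in> bounded_ops S"
proof -
  obtain C where C: "C \<ge> 0" "\<And>x. x \<in> ell2 S \<Longrightarrow> ell2_norm S (T x) \<le> C * ell2_norm S x"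
    using bounded_ops_bound[OF T] by blast
  obtain D where D: "D \<ge> 0" "\<And>x. x \<in> ell2 S \<Longrightarrow> ell2_norm S (U x) \<le> D * ell2_norm S x"
    using bounded_ops_bound[OF U] by blast
  have "ell2_norm S (T (U x)) \<le> (C * D) * ell2_norm S x" if x: "x \<in> ell2 S" for x
    using C(2)[OF bounded_ops_in_ell2[OF U x]] mult_left_mono[OF D(2)[OF x] C(1)]
    by (simp add: mult.assoc)
  then show ?thesis unfolding compose_def
    using T U by (intro bounded_opsI[where C = "C * D"])
      (auto simp: bounded_ops_in_ell2 bounded_ops_add bounded_ops_scale)
qed

lemma unital_operator_algebra_bounded_ops: "unital_operator_algebra S (bounded_ops S)"
  by (simp add: unital_operator_algebra_def op_id_in_bounded_ops op_scale_in_bounded_ops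
      op_add_in_bounded_ops op_mult_in_bounded_ops)

lemma bounded_ops_cutoff:
  assumes T: "T \<in> bounded_ops S" and x: "x \<in> ell2 S" and F: "finite F" "F \<subseteq> S"
  shows "T (cutoff F x) = (\<lambda>p. \<Sum>q\<in>F. x q * T (ket q) p)"
  using F
proof induction
  case empty
  then show ?case using bounded_ops_zero[OF T] by (simp add: cutoff_def)
next
  case (insert j F)
  have k: "ket j \<in> ell2 S" using insert.prems by (simp add: ket_in_ell2)
  have "cutoff (insert j F) x = (\<lambda>i. (\<lambda>i. x j * ket j i) i + cutoff F x i)"
    using insert.hyps by (auto simp: cutoff_def ket_def)
  then have "T (cutoff (insert j F) x) = (\<lambda>i. T (\<lambda>i. x j * ket j i) i + T (cutoff F x) i)"
    using bounded_ops_add[OF T ell2_scale[OF k] cutoff_in_ell2[OF x]] by simp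
  then show ?case using insert by (simp add: bounded_ops_scale[OF T k])
qed

text \<open>Truncated forms are finite sums over matrix entries \<open>T (ket q) p\<close>;
  entrywise information about operators enters the estimates through this formula.\<close>

lemma bounded_ops_cutoff_inner:
  assumes "T \<in> bounded_ops S" "x \<in> ell2 S" "finite F" "F \<subseteq> S"
  shows "ell2_inner S (T (cutoff F x)) (cutoff F y) = (\<Sum>p\<in>F. \<Sum>q\<in>F. x q * T (ket q) p * cnj (y p))"
  using assms by (simp add: ell2_inner_cutoff_right bounded_ops_cutoff sum_distrib_right)

text \<open>The constant \<open>C\<close> is a parameter instead of being extracted from
  \<open>T\<close>: with a common \<open>C\<close>, the same finite set \<open>F\<close> gives the
  same error for a whole sequence of operators.\<close>

lemma form_cutoff_approx:
  assumes T: "T \<in> bounded_ops S" and x: "x \<in> ell2 S" and y: "y \<in> ell2 S"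
    and C: "C \<ge> 0"
    and form: "\<And>x y. x \<in> ell2 S \<Longrightarrow> y \<in> ell2 S \<Longrightarrow>
      cmod (ell2_inner S (T x) y) \<le> C * ell2_norm S x * ell2_norm S y"
    and ex: "ell2_norm S (cutoff (- F) x) \<le> e" and ey: "ell2_norm S (cutoff (- F) y) \<le> e"
  shows "cmod (ell2_inner S (T x) y - ell2_inner S (T (cutoff F x)) (cutoff F y))
    \<le> e * (C * (ell2_norm S x + ell2_norm S y))"
proof -
  note c = cutoff_in_ell2[OF x] cutoff_in_ell2[OF y]
  have "T x = (\<lambda>i. T (cutoff F x) i + T (cutoff (- F) x) i)"
    using bounded_ops_add[OF T c(1)[of F] c(1)[of "- F"]] cutoff_split[of F x] by simp
  then have "ell2_inner S (T x) y = ell2_inner S (T (cutoff F x)) y + ell2_inner S (T (cutoff (- F) x)) y"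
    using ell2_inner_add_left[OF bounded_ops_in_ell2[OF T c(1)[of F]]
        bounded_ops_in_ell2[OF T c(1)[of "- F"]] y] by simp
  moreover have "ell2_inner S (T (cutoff F x)) y
      = ell2_inner S (T (cutoff F x)) (cutoff F y) + ell2_inner S (T (cutoff F x)) (cutoff (- F) y)"
    using ell2_inner_add_right[OF bounded_ops_in_ell2[OF T c(1)[of F]] c(2)[of F] c(2)[of "- F"]]
      cutoff_split[of F y] by simp
  ultimately have "cmod (ell2_inner S (T x) y - ell2_inner S (T (cutoff F x)) (cutoff F y))
      \<le> cmod (ell2_inner S (T (cutoff F x)) (cutoff (- F) y)) + cmod (ell2_inner S (T (cutoff (- F) x)) y)"
    by (simp add: norm_triangle_ineq)
  also have "\<dots> \<le> C * ell2_norm S (cutoff F x) * ell2_norm S (cutoff (- F) y)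
      + C * ell2_norm S (cutoff (- F) x) * ell2_norm S y"
    using c y by (intro add_mono form) auto
  also have "\<dots> \<le> C * ell2_norm S x * e + C * e * ell2_norm S y"
    using ex ey C ell2_norm_cutoff_le[OF x, of F]
    by (intro add_mono mult_mono mult_left_mono mult_right_mono)
      (auto simp: ell2_norm_nonneg intro!: mult_nonneg_nonneg)
  finally show ?thesis by (simp add: algebra_simps)
qed

lemma bounded_ops_form_bound:
  assumes "\<And>x. x \<in> ell2 S \<Longrightarrow> ell2_norm S (T x) \<le> C * ell2_norm S x" "T \<in> bounded_ops S"
    and x: "x \<in> ell2 S" and y: "y \<in> ell2 S"
  shows "cmod (ell2_inner S (T x) y) \<le> C * ell2_norm S x * ell2_norm S y"
  using ell2_cauchy_schwarz[OF bounded_ops_in_ell2[OF assms(2) x] y]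
    mult_right_mono[OF assms(1)[OF x] ell2_norm_nonneg[of S y]] by linarith

text \<open>Boundedness of \<open>T\<close> supplies some constant \<open>D\<close>, which makes the
  truncation error arbitrarily small; the constant \<open>C\<close> of the truncated forms then
  survives in the limit.\<close>

lemma form_bound_from_cutoffs:
  assumes T: "T \<in> bounded_ops S" and x: "x \<in> ell2 S" and y: "y \<in> ell2 S" and C: "C \<ge> 0"
    and cuts: "\<And>F. finite F \<Longrightarrow> F \<subseteq> S \<Longrightarrow> cmod (ell2_inner S (T (cutoff F x)) (cutoff F y))
      \<le> C * ell2_norm S (cutoff F x) * ell2_norm S (cutoff F y)"
  shows "cmod (ell2_inner S (T x) y) \<le> C * ell2_norm S x * ell2_norm S y"
proof -
  obtain D where D: "D \<ge> 0" "\<And>x. x \<in> ell2 S \<Longrightarrow> ell2_norm S (T x) \<le> D * ell2_norm S x"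
    using bounded_ops_bound[OF T] by blast
  let ?M = "D * (ell2_norm S x + ell2_norm S y)"
  have M: "?M \<ge> 0" using D(1) by (simp add: ell2_norm_nonneg)
  have "cmod (ell2_inner S (T x) y) \<le> C * ell2_norm S x * ell2_norm S y + e" if e: "e > 0" for e
  proof -
    \<comment> \<open>The summand 1 keeps the denominator positive when \<open>?M\<close> is
      zero.\<close>
    define d where "d = e / (?M + 1)"
    have d: "d > 0" using e M by (simp add: d_def)
    obtain F where F: "finite F" "F \<subseteq> S"
      "ell2_norm S (cutoff (- F) x) \<le> d" "ell2_norm S (cutoff (- F) y) \<le> d"
      using ell2_tail_pair[OF x y d] by blast
    have "cmod (ell2_inner S (T x) y - ell2_inner S (T (cutoff F x)) (cutoff F y)) \<le> d * ?M"
      by (rule form_cutoff_approx[OF T x y D(1) bounded_ops_form_bound[OF D(2) T] F(3,4)])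
    also have "\<dots> \<le> d * (?M + 1)" using d by simp
    also have "\<dots> = e" using M by (simp add: d_def)
    finally have 1: "cmod (ell2_inner S (T x) y - ell2_inner S (T (cutoff F x)) (cutoff F y)) \<le> e" .
    have "cmod (ell2_inner S (T (cutoff F x)) (cutoff F y)) \<le> C * ell2_norm S (cutoff F x) * ell2_norm S (cutoff F y)"
      by (rule cuts[OF F(1,2)])
    also have "\<dots> \<le> C * ell2_norm S x * ell2_norm S y"
      using C ell2_norm_cutoff_le[OF x, of F] ell2_norm_cutoff_le[OF y, of F]
      by (intro mult_mono) (auto simp: ell2_norm_nonneg)
    finally have 2: "cmod (ell2_inner S (T (cutoff F x)) (cutoff F y)) \<le> C * ell2_norm S x * ell2_norm S y" .
    show ?thesis
      using 1 2 norm_triangle_sub[of "ell2_inner S (T x) y" "ell2_inner S (T (cutoff F x)) (cutoff F y)"]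
      by linarith
  qed
  then show ?thesis by (rule field_le_epsilon)
qed

text \<open>The Riesz vector of the functional \<open>x \<mapsto> (T x) p\<close>, that is, the image of \<open>ket p\<close> under
  the adjoint of \<open>T\<close>.\<close>

lemma bounded_ops_coord_riesz:
  assumes T: "T \<in> bounded_ops S" and p: "p \<in> S"
  obtains z where "z \<in> ell2 S" "\<And>x. x \<in> ell2 S \<Longrightarrow> T x p = ell2_inner S x z"
proof -
  obtain D where D: "D \<ge> 0" "\<And>x. x \<in> ell2 S \<Longrightarrow> ell2_norm S (T x) \<le> D * ell2_norm S x"
    using bounded_ops_bound[OF T] by blast
  have coord: "cmod (T x p) \<le> D * ell2_norm S x" if "x \<in> ell2 S" for x
    using ell2_norm_coord[OF bounded_ops_in_ell2[OF T that]] D(2)[OF that] order_trans by blast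
  define z where "z j = (if j \<in> S then cnj (T (ket j) p) else 0)" for j
  \<comment> \<open>At the truncation of \<open>z\<close> itself the functional takes the squared
    norm of that truncation as its value, while its bound allows at most \<open>D\<close> times the
    norm. Hence the norm is at most \<open>D\<close>, uniformly in \<open>F\<close>.\<close>
  have bd: "(\<Sum>j\<in>F. (cmod (z j))\<^sup>2) \<le> D\<^sup>2" if F: "finite F" "F \<subseteq> S" for F
  proof -
    let ?s = "\<Sum>j\<in>F. (cmod (z j))\<^sup>2"
    let ?x = "cutoff F z"
    have n: "(ell2_norm S ?x)\<^sup>2 = ?s" by (rule ell2_norm_cutoff_power2[OF F])
    have "(\<lambda>i. (cmod (?x i))\<^sup>2) summable_on S"
      by (subst summable_on_cong_neutral[where T = F and g = "\<lambda>i. (cmod (z i))\<^sup>2"])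
        (use F in \<open>auto simp: cutoff_def\<close>)
    then have x: "?x \<in> ell2 S" using F by (auto simp: ell2_def cutoff_def)
    have "T (cutoff F ?x) p = (\<Sum>q\<in>F. ?x q * T (ket q) p)" using bounded_ops_cutoff[OF T x F] by simp
    also have "cutoff F ?x = ?x" by (auto simp: cutoff_def)
    also have "(\<Sum>q\<in>F. ?x q * T (ket q) p) = (\<Sum>q\<in>F. complex_of_real ((cmod (z q))\<^sup>2))"
      using F by (intro sum.cong) (auto simp: cutoff_def z_def complex_norm_square[unfolded of_real_power]
          mult.commute)
    finally have "T ?x p = complex_of_real ?s" by simp
    moreover have "0 \<le> ?s" by (simp add: sum_nonneg)
    ultimately have "cmod (T ?x p) = ?s" by (simp only: norm_of_real abs_of_nonneg)
    then have "?s \<le> D * ell2_norm S ?x" using coord[OF x] by simp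
    then have "ell2_norm S ?x * ell2_norm S ?x \<le> D * ell2_norm S ?x"
      using n by (simp add: power2_eq_square)
    then have "ell2_norm S ?x \<le> D"
      using ell2_norm_nonneg[of S ?x] D(1) by (cases "ell2_norm S ?x = 0") auto
    then show ?thesis using power_mono[OF _ ell2_norm_nonneg[of S ?x], of D 2] n by simp
  qed
  have "(\<lambda>j. (cmod (z j))\<^sup>2) summable_on S"
    by (rule nonneg_bdd_above_summable_on) (auto intro!: bdd_aboveI[of _ "D\<^sup>2"] bd)
  then have z: "z \<in> ell2 S" by (auto simp: ell2_def z_def)
  \<comment> \<open>Both sides agree on finitely supported vectors and are bounded linear
    functionals of \<open>x\<close>, so a tail estimate extends the equality to all of
    \<open>ell2 S\<close>.\<close>
  have "T x p = ell2_inner S x z" if x: "x \<in> ell2 S" for x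
  proof -
    let ?M = "D + ell2_norm S z"
    have M: "?M \<ge> 0" using D(1) by (simp add: ell2_norm_nonneg)
    have "cmod (T x p - ell2_inner S x z) \<le> e" if e: "e > 0" for e
    proof -
      define d where "d = e / (?M + 1)"
      have d: "d > 0" using e M by (simp add: d_def)
      obtain F where F: "finite F" "F \<subseteq> S" "ell2_norm S (cutoff (- F) x) \<le> d"
        using ell2_tail_pair[OF x x d] by blast
      note c = cutoff_in_ell2[OF x]
      have "T x p = T (cutoff F x) p + T (cutoff (- F) x) p"
        using bounded_ops_add[OF T c[of F] c[of "- F"]] cutoff_split[of F x] by simp
      moreover have "ell2_inner S x z = ell2_inner S (cutoff F x) z + ell2_inner S (cutoff (- F) x) z"
        using ell2_inner_add_left[OF c[of F] c[of "- F"] z] cutoff_split[of F x] by simp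
      moreover have "T (cutoff F x) p = ell2_inner S (cutoff F x) z"
      proof -
        have "ell2_inner S (cutoff F x) z = (\<Sum>\<^sub>\<infinity>i\<in>F. x i * cnj (z i))"
          unfolding ell2_inner_def by (rule infsum_cong_neutral) (use F in \<open>auto simp: cutoff_def\<close>)
        then show ?thesis using F by (auto simp: bounded_ops_cutoff[OF T x F(1,2)] z_def intro!: sum.cong)
      qed
      ultimately have "cmod (T x p - ell2_inner S x z)
          \<le> cmod (T (cutoff (- F) x) p) + cmod (ell2_inner S (cutoff (- F) x) z)"
        by (simp add: norm_triangle_ineq4)
      also have "\<dots> \<le> D * ell2_norm S (cutoff (- F) x) + ell2_norm S (cutoff (- F) x) * ell2_norm S z"
        by (intro add_mono coord ell2_cauchy_schwarz c z)
      also have "\<dots> = ?M * ell2_norm S (cutoff (- F) x)" by (simp add: algebra_simps)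
      also have "\<dots> \<le> ?M * d" by (rule mult_left_mono[OF F(3) M])
      also have "\<dots> \<le> (?M + 1) * d" using d by simp
      also have "\<dots> = e" using M by (simp add: d_def)
      finally show ?thesis .
    qed
    then have "cmod (T x p - ell2_inner S x z) \<le> 0" by (rule field_le_epsilon[of _ 0, simplified])
    then show ?thesis by simp
  qed
  then show thesis using that z by blast
qed


section \<open>Commutants and the weak operator topology\<close>

lemma continuous_map_wot_inner:
  assumes "x \<in> ell2 S" "y \<in> ell2 S"
  shows "continuous_map (wot S) euclidean (\<lambda>T. ell2_inner S (T x) y)"
proof -
  have "continuous_map (product_topology (\<lambda>_. euclidean) (ell2 S \<times> ell2 S)) euclidean
      (\<lambda>h. h (x, y) :: complex)"
    using assms by (intro continuous_map_product_projection) auto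
  from continuous_map_pullback[OF this, of "bounded_ops S"
      "\<lambda>T. \<lambda>(x, y)\<in>ell2 S \<times> ell2 S. ell2_inner S (T x) y"]
  show ?thesis
    using assms by (simp add: wot_def o_def)
qed

text \<open>Open sets of a pullback topology are preimages of open sets, so convergence reduces to
  the product topology, where it is componentwise.\<close>

lemma limitin_wot:
  assumes "\<And>n. f n \<in> bounded_ops S" "T \<in> bounded_ops S"
    and lim: "\<And>x y. x \<in> ell2 S \<Longrightarrow> y \<in> ell2 S \<Longrightarrow>
      ((\<lambda>n. ell2_inner S (f n x) y) \<longlongrightarrow> ell2_inner S (T x) y) F"
  shows "limitin (wot S) f T F"
proof -
  let ?c = "\<lambda>T. \<lambda>(x, y)\<in>ell2 S \<times> ell2 S. ell2_inner S (T x) y"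
  let ?P = "product_topology (\<lambda>_. euclidean) (ell2 S \<times> ell2 S) :: (_ \<Rightarrow> complex) topology"
  have L: "limitin ?P (\<lambda>n. ?c (f n)) (?c T) F"
    unfolding limitin_componentwise using lim by (auto simp: PiE_def)
  show ?thesis
    unfolding limitin_def topspace_wot
  proof (intro conjI allI impI)
    fix U assume U: "openin (wot S) U \<and> T \<in> U"
    then obtain V where V: "openin ?P V" "U = ?c -` V \<inter> bounded_ops S"
      unfolding wot_def openin_pullback_topology by blast
    then have "eventually (\<lambda>n. ?c (f n) \<in> V) F"
      using L U unfolding limitin_def by blast
    then show "eventually (\<lambda>n. f n \<in> U) F"
      using V(2) assms(1) by simp
  qed (rule assms(2))
qed

section \<open>Commutants as closed unital algebras\<close>

lemma op_mult_eq_iff: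
  "op_mult S T U = op_mult S U T \<longleftrightarrow> (\<forall>x\<in>ell2 S. T (U x) = U (T x))"
proof
  assume eq: "op_mult S T U = op_mult S U T"
  show "\<forall>x\<in>ell2 S. T (U x) = U (T x)"
  proof
    fix x assume "x \<in> ell2 S"
    then show "T (U x) = U (T x)" using fun_cong[OF eq, of x] by (simp add: compose_def)
  qed
next
  assume "\<forall>x\<in>ell2 S. T (U x) = U (T x)"
  then show "op_mult S T U = op_mult S U T" unfolding compose_def by (intro restrict_ext) blast
qed

lemma commutant_iff:
  "T \<in> commutant S A \<longleftrightarrow> T \<in> bounded_ops S \<and> (\<forall>U\<in>A. \<forall>x\<in>ell2 S. T (U x) = U (T x))"
  by (simp add: commutant_def op_mult_eq_iff)

lemma commutant_subset: "commutant S A \<subseteq> bounded_ops S"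
  by (auto simp: commutant_def)

text \<open>For fixed \<open>U\<close>, \<open>x\<close> and \<open>p\<close>, commutation is an
  equality of two continuous functions of \<open>T\<close>. The coordinate of \<open>T (U x)\<close>
  is a matrix coefficient directly; that of \<open>U (T x)\<close> becomes one after
  \<open>U\<close> is moved to the other side by its Riesz vector.\<close>

lemma closedin_commutant:
  assumes A: "A \<subseteq> bounded_ops S"
  shows "closedin (wot S) (commutant S A)"
proof -
  define K where "K = (\<lambda>(U, x, p). {T \<in> bounded_ops S. T (U x) p = U (T x) p})"
  have cl: "closedin (wot S) (K (U, x, p))" if U: "U \<in> A" and x: "x \<in> ell2 S" and p: "p \<in> S" for U x p
  proof -
    obtain z where z: "z \<in> ell2 S" "\<And>x. x \<in> ell2 S \<Longrightarrow> U x p = ell2_inner S x z"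
      using bounded_ops_coord_riesz[of U S p] A U p by blast
    have "closedin (wot S) {T \<in> topspace (wot S).
        ell2_inner S (T (U x)) (ket p) = ell2_inner S (T x) z}"
      using A U x p z
      by (intro closedin_continuous_maps_eq[of euclidean] continuous_map_wot_inner)
        (auto simp: ket_in_ell2 bounded_ops_in_ell2)
    also have "{T \<in> topspace (wot S). ell2_inner S (T (U x)) (ket p) = ell2_inner S (T x) z} = K (U, x, p)"
      using x p z(2) by (auto simp: K_def topspace_wot ell2_inner_ket bounded_ops_in_ell2)
    finally show ?thesis .
  qed
  \<comment> \<open>Inserting \<open>bounded_ops S\<close> keeps the family nonempty, and its
    intersection inside the space, even if \<open>A\<close> or \<open>S\<close> is empty.\<close>
  have eq: "commutant S A = \<Inter>(insert (bounded_ops S) (K ` (A \<times> ell2 S \<times> S)))" (is "_ = ?R")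
  proof
    show "commutant S A \<subseteq> ?R" using commutant_iff by (auto simp: K_def)
    show "?R \<subseteq> commutant S A"
    proof
      fix T assume "T \<in> ?R"
      then have T: "T \<in> bounded_ops S"
        and c: "\<And>U x p. U \<in> A \<Longrightarrow> x \<in> ell2 S \<Longrightarrow> p \<in> S \<Longrightarrow> T (U x) p = U (T x) p"
        by (auto simp: K_def)
      have "T (U x) = U (T x)" if "U \<in> A" "x \<in> ell2 S" for U x
      proof
        fix p
        have U: "U \<in> bounded_ops S" using A that(1) by blast
        note e = bounded_ops_in_ell2
        have "T (U x) \<in> ell2 S" by (rule e[OF T e[OF U that(2)]])
        moreover have "U (T x) \<in> ell2 S" by (rule e[OF U e[OF T that(2)]])
        ultimately show "T (U x) p = U (T x) p"
          using c[OF that, of p] by (cases "p \<in> S") (auto simp: ell2_def)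
      qed
      then show "T \<in> commutant S A" using T by (simp add: commutant_iff)
    qed
  qed
  have "closedin (wot S) (bounded_ops S)"
    using closedin_topspace[of "wot S"] by (simp add: topspace_wot)
  then show ?thesis unfolding eq using cl by (intro closedin_Inter) auto
qed

lemma
  assumes "x \<in> ell2 S"
  shows op_id_apply: "op_id S x = x"
    and op_add_apply: "op_add S T U x = (\<lambda>i. T x i + U x i)"
    and op_scale_apply: "op_scale S c T x = (\<lambda>i. c * T x i)"
    and op_mult_apply: "op_mult S T U x = T (U x)"
  using assms by (simp_all add: op_id_def op_add_def op_scale_def compose_def)

lemma unital_operator_algebra_commutant:
  assumes A: "A \<subseteq> bounded_ops S"
  shows "unital_operator_algebra S (commutant S A)"
  unfolding unital_operator_algebra_def
proof (intro conjI ballI allI)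
  have U: "U \<in> bounded_ops S" if "U \<in> A" for U using A that by blast
  note e = bounded_ops_in_ell2[OF U]
  show "commutant S A \<subseteq> bounded_ops S" by (rule commutant_subset)
  show "op_id S \<in> commutant S A"
    by (simp add: commutant_iff op_id_in_bounded_ops op_id_apply e)
  fix T T' assume TT': "T \<in> commutant S A" "T' \<in> commutant S A"
  then have T: "T \<in> bounded_ops S" "T' \<in> bounded_ops S"
    and c: "\<And>U x. U \<in> A \<Longrightarrow> x \<in> ell2 S \<Longrightarrow> T (U x) = U (T x)"
      "\<And>U x. U \<in> A \<Longrightarrow> x \<in> ell2 S \<Longrightarrow> T' (U x) = U (T' x)"
    by (auto simp: commutant_iff)
  note eT = bounded_ops_in_ell2[OF T(1)] bounded_ops_in_ell2[OF T(2)]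
  show "op_add S T T' \<in> commutant S A"
    by (simp add: commutant_iff op_add_in_bounded_ops T op_add_apply e c bounded_ops_add[OF U] eT)
  show "op_mult S T T' \<in> commutant S A"
    by (simp add: commutant_iff op_mult_in_bounded_ops T op_mult_apply e c eT)
next
  fix c T assume T': "T \<in> commutant S A"
  have U: "U \<in> bounded_ops S" if "U \<in> A" for U using A that by blast
  note e = bounded_ops_in_ell2[OF U]
  have T: "T \<in> bounded_ops S"
    and c: "\<And>U x. U \<in> A \<Longrightarrow> x \<in> ell2 S \<Longrightarrow> T (U x) = U (T x)"
    using T' by (auto simp: commutant_iff)
  show "op_scale S c T \<in> commutant S A"
    by (simp add: commutant_iff op_scale_in_bounded_ops T op_scale_apply e c bounded_ops_scale[OF U]
        bounded_ops_in_ell2[OF T])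
qed

section \<open>The closed algebra generated by a set of bounded operators\<close>

context
  fixes S :: "'i set" and X :: "'i operator set"
  assumes X: "X \<subseteq> bounded_ops S"
begin

lemma wot_algebra_minimal:
  assumes "unital_operator_algebra S A" "closedin (wot S) A" "X \<subseteq> A"
  shows "wot_algebra_generated_by S X \<subseteq> A"
  using assms by (auto simp: wot_algebra_generated_by_def)

text \<open>Since \<open>X\<close> consists of bounded operators, \<open>bounded_ops S\<close> is
  itself one of the intersected algebras.\<close>

lemma wot_algebra_subset_bounded_ops: "wot_algebra_generated_by S X \<subseteq> bounded_ops S"
  using X closedin_topspace[of "wot S"]
  by (intro wot_algebra_minimal unital_operator_algebra_bounded_ops) (simp_all add: topspace_wot)

lemma subset_wot_algebra: "X \<subseteq> wot_algebra_generated_by S X"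
  by (auto simp: wot_algebra_generated_by_def)

lemma closedin_wot_algebra: "closedin (wot S) (wot_algebra_generated_by S X)"
  unfolding wot_algebra_generated_by_def
  using X closedin_topspace[of "wot S"] unital_operator_algebra_bounded_ops[of S]
  by (intro closedin_Inter) (auto simp: topspace_wot)

lemma unital_operator_algebra_wot_algebra:
  "unital_operator_algebra S (wot_algebra_generated_by S X)"
  unfolding unital_operator_algebra_def
  using wot_algebra_subset_bounded_ops
  by (auto simp: wot_algebra_generated_by_def unital_operator_algebra_def)

text \<open>The commutant of \<open>{T}\<close> is a closed unital algebra, so it contains the
  generated algebra as soon as it contains \<open>X\<close>. Commutation therefore has to be checked
  on generators only.\<close>

lemma commutant_subset_commutant_wot_algebra:
  "commutant S X \<subseteq> commutant S (wot_algebra_generated_by S X)"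
proof
  fix T assume T: "T \<in> commutant S X"
  then have TB: "{T} \<subseteq> bounded_ops S" by (simp add: commutant_def)
  have "X \<subseteq> commutant S {T}" using T X by (auto simp: commutant_def)
  then have "wot_algebra_generated_by S X \<subseteq> commutant S {T}"
    by (intro wot_algebra_minimal unital_operator_algebra_commutant closedin_commutant TB)
  then show "T \<in> commutant S (wot_algebra_generated_by S X)"
    using TB by (auto simp: commutant_def)
qed

end

lemma subset_double_commutant: "A \<subseteq> bounded_ops S \<Longrightarrow> A \<subseteq> commutant S (commutant S A)"
  by (auto simp: commutant_def)

text \<open>The linear combination is described by its coordinates and built up inside
  \<open>A\<close>, starting from zero times the identity.\<close>

lemma unital_operator_algebra_sum:
  assumes A: "unital_operator_algebra S A" and W: "finite W" and f: "\<And>w. w \<in> W \<Longrightarrow> f w \<in> A"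
  shows "\<exists>T\<in>A. \<forall>x\<in>ell2 S. \<forall>p. T x p = (\<Sum>w\<in>W. c w * f w x p)"
  using W f
proof induction
  case empty
  have "op_scale S 0 (op_id S) \<in> A" using A by (simp add: unital_operator_algebra_def)
  then show ?case by (rule bexI[rotated]) (simp add: op_scale_apply)
next
  case (insert w W)
  then obtain T where T: "T \<in> A" "\<forall>x\<in>ell2 S. \<forall>p. T x p = (\<Sum>w\<in>W. c w * f w x p)" by auto
  have "op_add S (op_scale S (c w) (f w)) T \<in> A"
    using A T(1) insert.prems by (simp add: unital_operator_algebra_def)
  then show ?case
    by (rule bexI[rotated]) (use T(2) insert.hyps in \<open>simp add: op_add_apply op_scale_apply\<close>)
qed


section \<open>Fejer means along a grading\<close>

text \<open>For \<open>k > 0\<close> this is the Fejer multiplier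
  \<open>max 0 (1 - |m - n| / k)\<close>: the truncated subtraction of naturals makes it vanish once
  the degrees differ by at least \<open>k\<close>.\<close>

definition fejer :: "nat \<Rightarrow> nat \<Rightarrow> nat \<Rightarrow> real" where
  "fejer k m n = real (min m n + k - max m n) / real k"

text \<open>The windows common to both degrees have the indices from \<open>max m n + 1\<close> to
  \<open>min m n + k\<close>, all of them at most \<open>N\<close>. The codomain is general because
  the count occurs in complex sums (forms) and in real ones (squared norms).\<close>

lemma sum_windows:
  assumes "m + k \<le> N"
  shows "(\<Sum>i\<le>N. of_bool (m < i \<and> i \<le> m + k \<and> n < i \<and> i \<le> n + k))
    = (of_nat (min m n + k - max m n) :: 'c::semiring_1)"
proof -
  have "{..N} \<inter> {i. m < i \<and> i \<le> m + k \<and> n < i \<and> i \<le> n + k} = {max m n<..min m n + k}"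
    using assms by auto
  then show ?thesis by (simp add: sum.If_cases of_bool_def)
qed

lemma tendsto_fejer: "(\<lambda>k. fejer (Suc k) m n) \<longlonglongrightarrow> 1"
proof -
  have "(\<lambda>k. 1 - real (max m n - min m n) / real (Suc k)) \<longlonglongrightarrow> 1 - 0"
    by (intro tendsto_diff tendsto_const LIMSEQ_Suc lim_const_over_n)
  \<comment> \<open>Once \<open>k\<close> is at least \<open>max m n\<close>, the natural
    subtraction in \<open>fejer\<close> is exact.\<close>
  moreover have "\<forall>\<^sub>F k in sequentially. 1 - real (max m n - min m n) / real (Suc k) = fejer (Suc k) m n"
    using eventually_ge_at_top[of "max m n"]
  proof eventually_elim
    case (elim k)
    then have "real (min m n + Suc k - max m n) = real (Suc k) - real (max m n - min m n)"
      by (simp add: of_nat_diff)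
    then show ?case by (simp add: fejer_def diff_divide_distrib)
  qed
  ultimately show ?thesis by (simp add: tendsto_cong)
qed

text \<open>The multiplier \<^const>\<open>fejer\<close> is the average over \<open>i\<close> of the compressions of \<open>T\<close> to the
  windows \<open>{p. len p < i \<and> i \<le> len p + k}\<close>, each point lying in exactly \<open>k\<close> windows. Therefore
  Schur multiplication by it does not increase the norm.\<close>

lemma fejer_form_bound:
  fixes len :: "'i \<Rightarrow> nat"
  assumes T: "T \<in> bounded_ops S" and A: "A \<in> bounded_ops S" and k: "k > 0" and C: "C \<ge> 0"
    and bound: "\<And>x. x \<in> ell2 S \<Longrightarrow> ell2_norm S (T x) \<le> C * ell2_norm S x"
    and AT: "\<And>p q. p \<in> S \<Longrightarrow> q \<in> S \<Longrightarrow> A (ket q) p = of_real (fejer k (len p) (len q)) * T (ket q) p"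
    and x: "x \<in> ell2 S" and y: "y \<in> ell2 S"
  shows "cmod (ell2_inner S (A x) y) \<le> C * ell2_norm S x * ell2_norm S y"
proof (rule form_bound_from_cutoffs[OF A x y C])
  fix F assume F: "finite F" "F \<subseteq> S"
  obtain M where M: "\<And>p. p \<in> F \<Longrightarrow> len p \<le> M"
    using F(1) by (meson Max_ge finite_imageI image_eqI)
  \<comment> \<open>Every window that meets \<open>F\<close> has index at most \<open>N\<close>, so
    summing over \<open>i \<le> N\<close> misses none.\<close>
  define N where "N = M + k"
  have N: "len p + k \<le> N" if "p \<in> F" for p using M[OF that] by (simp add: N_def)
  define W where "W i = {p. len p < i \<and> i \<le> len p + k}" for i
  have fW: "finite (F \<inter> W i)" "F \<inter> W i \<subseteq> S" for i using F by auto
  \<comment> \<open>The form of \<open>T\<close> compressed to window \<open>i\<close>. A matrix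
    entry contributes when both of its indices lie in the window, so the sum over \<open>i\<close>
    counts it \<open>k\<close> times its Fejer factor.\<close>
  define I where "I i = ell2_inner S (T (cutoff (F \<inter> W i) x)) (cutoff (F \<inter> W i) y)" for i
  have I: "I i = (\<Sum>p\<in>F. \<Sum>q\<in>F. of_bool (len p < i \<and> i \<le> len p + k \<and> len q < i \<and> i \<le> len q + k)
      * (x q * T (ket q) p * cnj (y p)))" for i
    unfolding I_def bounded_ops_cutoff_inner[OF T x fW] sum.inter_restrict[OF F(1)]
    by (intro sum.cong refl) (auto simp: W_def intro!: sum.cong)
  have "(\<Sum>i\<le>N. I i) = (\<Sum>p\<in>F. \<Sum>q\<in>F. \<Sum>i\<le>N.
      of_bool (len p < i \<and> i \<le> len p + k \<and> len q < i \<and> i \<le> len q + k) * (x q * T (ket q) p * cnj (y p)))"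
    unfolding I by (subst sum.swap, rule sum.cong[OF refl], subst sum.swap, rule refl)
  also have "\<dots> = (\<Sum>p\<in>F. \<Sum>q\<in>F. of_real (real k) * (x q * A (ket q) p * cnj (y p)))"
  proof (intro sum.cong refl)
    fix p q assume p: "p \<in> F" and q: "q \<in> F"
    have "of_real (real k) * A (ket q) p
        = of_real (real (min (len p) (len q) + k - max (len p) (len q))) * T (ket q) p"
      using F p q k by (subst AT) (auto simp: fejer_def)
    then show "(\<Sum>i\<le>N. of_bool (len p < i \<and> i \<le> len p + k \<and> len q < i \<and> i \<le> len q + k)
        * (x q * T (ket q) p * cnj (y p))) = of_real (real k) * (x q * A (ket q) p * cnj (y p))"
      unfolding sum_distrib_right[symmetric] sum_windows[OF N[OF p]] by simp
  qed
  also have "\<dots> = of_real (real k) * ell2_inner S (A (cutoff F x)) (cutoff F y)"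
    by (simp add: bounded_ops_cutoff_inner[OF A x F] sum_distrib_left)
  finally have sumI: "(\<Sum>i\<le>N. I i) = of_real (real k) * ell2_inner S (A (cutoff F x)) (cutoff F y)" .
  define n where "n z i = ell2_norm S (cutoff (F \<inter> W i) z)" for z :: "'i \<Rightarrow> complex" and i
  \<comment> \<open>Each point of \<open>F\<close> lies in exactly \<open>k\<close> windows, so the
    squared norms of the pieces add up to \<open>k\<close> times that of the whole.\<close>
  have L2: "L2_set (n z) {..N} = sqrt (real k) * ell2_norm S (cutoff F z)" for z
  proof -
    have "(\<Sum>i\<le>N. (n z i)\<^sup>2) = (\<Sum>i\<le>N. \<Sum>q\<in>F. of_bool (len q < i \<and> i \<le> len q + k) * (cmod (z q))\<^sup>2)"
      unfolding n_def ell2_norm_cutoff_power2[OF fW] sum.inter_restrict[OF F(1)]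
      by (intro sum.cong refl) (auto simp: W_def)
    also have "\<dots> = (\<Sum>q\<in>F. \<Sum>i\<le>N. of_bool (len q < i \<and> i \<le> len q + k) * (cmod (z q))\<^sup>2)"
      by (rule sum.swap)
    also have "\<dots> = (\<Sum>q\<in>F. real k * (cmod (z q))\<^sup>2)"
    proof (intro sum.cong refl)
      fix q assume "q \<in> F"
      from sum_windows[OF N[OF this], where n = "len q" and 'c = real]
      show "(\<Sum>i\<le>N. of_bool (len q < i \<and> i \<le> len q + k) * (cmod (z q))\<^sup>2) = real k * (cmod (z q))\<^sup>2"
        by (simp add: sum_distrib_right[symmetric] conj_ac)
    qed
    also have "\<dots> = real k * (ell2_norm S (cutoff F z))\<^sup>2"
      by (simp add: ell2_norm_cutoff_power2[OF F] sum_distrib_left)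
    finally show ?thesis by (simp add: L2_set_def real_sqrt_mult ell2_norm_nonneg)
  qed
  have "real k * cmod (ell2_inner S (A (cutoff F x)) (cutoff F y)) = cmod (\<Sum>i\<le>N. I i)"
    unfolding sumI norm_mult by simp
  also have "\<dots> \<le> (\<Sum>i\<le>N. cmod (I i))" by (rule norm_sum)
  \<comment> \<open>Each compression is bounded by \<open>C\<close>. Cauchy-Schwarz over
    \<open>i\<close> then produces two factors \<open>sqrt k\<close>, whose product cancels the
    \<open>k\<close> on the left.\<close>
  also have "\<dots> \<le> (\<Sum>i\<le>N. C * (\<bar>n x i\<bar> * \<bar>n y i\<bar>))"
  proof (rule sum_mono)
    fix i
    have "cmod (I i) \<le> C * n x i * n y i" unfolding I_def n_def
      by (rule bounded_ops_form_bound[OF bound T cutoff_in_ell2[OF x] cutoff_in_ell2[OF y]])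
    then show "cmod (I i) \<le> C * (\<bar>n x i\<bar> * \<bar>n y i\<bar>)"
      by (simp add: n_def ell2_norm_nonneg mult.assoc)
  qed
  also have "\<dots> = C * (\<Sum>i\<le>N. \<bar>n x i\<bar> * \<bar>n y i\<bar>)" by (simp add: sum_distrib_left)
  also have "\<dots> \<le> C * (L2_set (n x) {..N} * L2_set (n y) {..N})"
    by (rule mult_left_mono[OF L2_set_mult_ineq C])
  also have "\<dots> = real k * (C * ell2_norm S (cutoff F x) * ell2_norm S (cutoff F y))"
    unfolding L2 by (simp add: algebra_simps)
  finally show "cmod (ell2_inner S (A (cutoff F x)) (cutoff F y))
      \<le> C * ell2_norm S (cutoff F x) * ell2_norm S (cutoff F y)"
    using k by simp
qed

text \<open>The forms of all \<open>A k\<close> obey the bound \<open>C\<close> of \<open>T\<close>,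
  so one truncation of \<open>x\<close> and \<open>y\<close> is good for every \<open>k\<close>; on
  it the forms are finite sums and converge entry by entry.\<close>

lemma limitin_fejer:
  fixes len :: "'i \<Rightarrow> nat"
  assumes T: "T \<in> bounded_ops S" and A: "\<And>k. A k \<in> bounded_ops S"
    and AT: "\<And>k p q. p \<in> S \<Longrightarrow> q \<in> S \<Longrightarrow>
      A k (ket q) p = of_real (fejer (Suc k) (len p) (len q)) * T (ket q) p"
  shows "limitin (wot S) A T sequentially"
proof (rule limitin_wot[OF A T])
  fix x y assume x: "x \<in> ell2 S" and y: "y \<in> ell2 S"
  obtain C where C: "C \<ge> 0" "\<And>x. x \<in> ell2 S \<Longrightarrow> ell2_norm S (T x) \<le> C * ell2_norm S x"
    using bounded_ops_bound[OF T] by blast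
  define M where "M = C * (ell2_norm S x + ell2_norm S y)"
  have M: "M \<ge> 0" using C(1) by (simp add: M_def ell2_norm_nonneg)
  show "(\<lambda>k. ell2_inner S (A k x) y) \<longlonglongrightarrow> ell2_inner S (T x) y"
    unfolding tendsto_iff dist_norm
  proof (intro allI impI)
    fix e :: real assume e: "e > 0"
    \<comment> \<open>The two truncation errors are at most \<open>d * M\<close> each, hence at most
      \<open>e / 3\<close>; the finite forms account for the last third, strictly.\<close>
    define d where "d = e / (3 * (M + 1))"
    have d: "d > 0" using e M by (simp add: d_def)
    have "d * M \<le> d * (M + 1)" using d by simp
    also have "\<dots> = e / 3" using M by (simp add: d_def field_simps)
    finally have dM: "d * M \<le> e / 3" .
    obtain F where F: "finite F" "F \<subseteq> S"
      "ell2_norm S (cutoff (- F) x) \<le> d" "ell2_norm S (cutoff (- F) y) \<le> d"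
      using ell2_tail_pair[OF x y d] by blast
    let ?I = "\<lambda>B. ell2_inner S (B (cutoff F x)) (cutoff F y)"
    have "(\<lambda>k. \<Sum>p\<in>F. \<Sum>q\<in>F. x q * (of_real (fejer (Suc k) (len p) (len q)) * T (ket q) p) * cnj (y p))
        \<longlonglongrightarrow> (\<Sum>p\<in>F. \<Sum>q\<in>F. x q * (of_real 1 * T (ket q) p) * cnj (y p))"
      by (intro tendsto_sum tendsto_mult tendsto_const tendsto_of_real tendsto_fejer)
    moreover have "?I (A k)
        = (\<Sum>p\<in>F. \<Sum>q\<in>F. x q * (of_real (fejer (Suc k) (len p) (len q)) * T (ket q) p) * cnj (y p))" for k
      unfolding bounded_ops_cutoff_inner[OF A x F(1,2)]
      using F(2) by (intro sum.cong refl) (simp add: AT subset_iff)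
    moreover have "?I T = (\<Sum>p\<in>F. \<Sum>q\<in>F. x q * (of_real 1 * T (ket q) p) * cnj (y p))"
      unfolding bounded_ops_cutoff_inner[OF T x F(1,2)] by simp
    ultimately have lim: "(\<lambda>k. ?I (A k)) \<longlonglongrightarrow> ?I T" by simp
    have "\<forall>\<^sub>F k in sequentially. cmod (?I (A k) - ?I T) < e / 3"
      using tendstoD[OF lim, of "e / 3"] e unfolding dist_norm by simp
    then show "\<forall>\<^sub>F k in sequentially. cmod (ell2_inner S (A k x) y - ell2_inner S (T x) y) < e"
    proof eventually_elim
      case (elim k)
      have "cmod (ell2_inner S (A k x) y - ?I (A k)) \<le> d * M"
        using fejer_form_bound[OF T A _ C AT]
        unfolding M_def by (intro form_cutoff_approx[OF A x y C(1) _ F(3,4)]) simp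
      moreover have "cmod (ell2_inner S (T x) y - ?I T) \<le> d * M"
        unfolding M_def by (rule form_cutoff_approx[OF T x y C(1) bounded_ops_form_bound[OF C(2) T] F(3,4)])
      moreover have "cmod (a - b) \<le> cmod (a - a') + cmod (a' - b') + cmod (b - b')" for a b a' b'
        using norm_triangle_ineq4[of "a - a' + (a' - b')" "b - b'"]
          norm_triangle_ineq[of "a - a'" "a' - b'"] by simp
      note this[of "ell2_inner S (A k x) y" "ell2_inner S (T x) y" "?I (A k)" "?I T"]
      ultimately show ?case using elim dM by linarith
    qed
  qed
qed


section \<open>Composition of paths\<close>

lemma psource_pcomp [simp]: "psource (pcomp w v) = psource v"
  by (simp add: psource_def pcomp_def)

lemma pcomp_assoc: "pcomp w (pcomp v u) = pcomp (pcomp w v) u"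
  by (simp add: pcomp_def)

lemma pcomp_vertex_right: "pcomp w (vertex_path (psource w)) = w"
  by (simp add: pcomp_def vertex_path_def psource_def)

lemma pcomp_vertex_left: "pcomp (vertex_path x) v = v"
  by (simp add: pcomp_def vertex_path_def)

lemma prange_vertex_path [simp]: "prange G (vertex_path x) = x"
  by (simp add: prange_def vertex_path_def pre_digraph.awalk_verts.simps)

lemma psource_vertex_path [simp]: "psource (vertex_path x) = x"
  by (simp add: psource_def vertex_path_def)

text \<open>\<open>pcomp\<close> keeps the source of the right factor and forgets that of the left
  one, so equality of the left sources has to be assumed.\<close>

lemma pcomp_right_cancel:
  assumes "pcomp w v = pcomp w' v" "psource w = psource w'" shows "w = w'"
  using assms by (auto simp: pcomp_def psource_def prod_eq_iff)

lemma length_snd_pcomp: "length (snd (pcomp w v)) = length (snd w) + length (snd v)"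
  by (simp add: pcomp_def)

context fin_digraph
begin

lemma prange_pcomp: "composable G w v \<Longrightarrow> prange G (pcomp w v) = prange G w"
  by (simp add: composable_def prange_def pcomp_def psource_def awlast_append)

lemma pcomp_path: "composable G w v \<Longrightarrow> pcomp w v \<in> paths G"
  by (rule pcomp_in_paths[OF fin_digraph_axioms])

lemma composable_pcomp_right:
  "composable G v u \<Longrightarrow> composable G w (pcomp v u) \<longleftrightarrow> composable G w v"
  using pcomp_path[of v u] prange_pcomp[of v u] by (auto simp: composable_def)

lemma composable_pcomp_left:
  "composable G w v \<Longrightarrow> composable G (pcomp w v) u \<longleftrightarrow> composable G v u"
  using pcomp_path[of w v] by (auto simp: composable_def)

lemma vertex_path_psource: "v \<in> paths G \<Longrightarrow> vertex_path (psource v) \<in> paths G"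
  by (auto simp: paths_def vertex_path_def psource_def awalk_def)

lemma vertex_path_prange: "v \<in> paths G \<Longrightarrow> vertex_path (prange G v) \<in> paths G"
  using awalk_last_in_verts by (auto simp: paths_def vertex_path_def prange_def awalk_Nil_iff)

lemma composable_vertex_right: "v \<in> paths G \<Longrightarrow> composable G v (vertex_path (psource v))"
  by (simp add: composable_def vertex_path_psource)

lemma composable_vertex_left: "v \<in> paths G \<Longrightarrow> composable G (vertex_path (prange G v)) v"
  by (simp add: composable_def vertex_path_prange)

text \<open>Finiteness of the graph makes each Cesaro sum a finite combination of shifts.\<close>

lemma finite_short_paths: "finite {w \<in> paths G. length (snd w) < k}"
proof (rule finite_subset)
  show "{w \<in> paths G. length (snd w) < k} \<subseteq> verts G \<times> {es. set es \<subseteq> arcs G \<and> length es \<le> k}"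
    by (auto simp: paths_def awalk_def)
  show "finite (verts G \<times> {es. set es \<subseteq> arcs G \<and> length es \<le> k})"
    by (intro finite_cartesian_product finite_lists_length_le) auto
qed

end


section \<open>Right shifts\<close>

text \<open>Reindexing squares along the injection \<open>f\<close> bounds the norm by
  \<open>C\<close>. The operator is described by its coordinates at every \<open>x\<close>, not just
  at basis vectors, because coordinates of images of \<open>T (ket q)\<close> are read off
  later.\<close>

lemma ex_injective_shift:
  fixes c :: "'i \<Rightarrow> complex"
  assumes D: "D \<subseteq> S" and inj: "inj_on f D" and im: "f ` D \<subseteq> S"
    and c: "\<And>v. v \<in> D \<Longrightarrow> cmod (c v) \<le> C" and C: "C \<ge> 0"
  shows "\<exists>R\<in>bounded_ops S. \<forall>x\<in>ell2 S.
    (\<forall>v\<in>D. R x (f v) = c v * x v) \<and> (\<forall>p. p \<notin> f ` D \<longrightarrow> R x p = 0)"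
proof -
  define W where "W x p = (if p \<in> f ` D then c (the_inv_into D f p) * x (the_inv_into D f p) else 0)"
    for x and p
  have Wf: "W x (f v) = c v * x v" if "v \<in> D" for x v
    using that inj by (simp add: W_def the_inv_into_f_f)
  have W0: "W x p = 0" if "p \<notin> f ` D" for x p using that by (simp add: W_def)
  have cm: "(cmod (W x (f v)))\<^sup>2 \<le> C\<^sup>2 * (cmod (x v))\<^sup>2" if "v \<in> D" for x v
    using c[OF that] by (simp add: Wf[OF that] norm_mult power_mult_distrib mult_right_mono power_mono)
  have "W x \<in> ell2 S \<and> ell2_norm S (W x) \<le> C * ell2_norm S x" if x: "x \<in> ell2 S" for x
  proof -
    have s: "(\<lambda>v. C\<^sup>2 * (cmod (x v))\<^sup>2) summable_on S"
      using x by (auto simp: ell2_def intro: summable_on_cmult_right)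
    have sD: "(\<lambda>v. (cmod (W x (f v)))\<^sup>2) summable_on D"
      by (rule summable_on_comparison_test[OF summable_on_subset_banach[OF s D]]) (auto intro: cm)
    then have "(\<lambda>p. (cmod (W x p))\<^sup>2) summable_on f ` D"
      using summable_on_reindex[OF inj, of "\<lambda>p. (cmod (W x p))\<^sup>2"] by (simp add: o_def)
    then have "(\<lambda>p. (cmod (W x p))\<^sup>2) summable_on S"
      by (subst summable_on_cong_neutral[where T = "f ` D" and g = "\<lambda>p. (cmod (W x p))\<^sup>2"])
        (use im W0 in auto)
    moreover have "W x p = 0" if "p \<notin> S" for p using that im by (intro W0) blast
    moreover have "(\<Sum>\<^sub>\<infinity>p\<in>S. (cmod (W x p))\<^sup>2) = (\<Sum>\<^sub>\<infinity>p\<in>f ` D. (cmod (W x p))\<^sup>2)"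
      by (rule infsum_cong_neutral) (use im W0 in auto)
    moreover have "\<dots> = (\<Sum>\<^sub>\<infinity>v\<in>D. (cmod (W x (f v)))\<^sup>2)"
      using infsum_reindex[OF inj, of "\<lambda>p. (cmod (W x p))\<^sup>2"] by (simp add: o_def)
    moreover have "\<dots> \<le> (\<Sum>\<^sub>\<infinity>v\<in>S. C\<^sup>2 * (cmod (x v))\<^sup>2)"
      by (rule infsum_mono_neutral[OF sD s]) (use D cm in auto)
    moreover have "\<dots> = (C * ell2_norm S x)\<^sup>2"
      by (simp add: infsum_cmult_right' power_mult_distrib ell2_norm_power2)
    ultimately show ?thesis
      using C unfolding ell2_def ell2_norm_def[of S "W x"]
      by (auto intro!: real_le_lsqrt simp: infsum_nonneg ell2_norm_nonneg)
  qed
  then have "(\<lambda>x\<in>ell2 S. W x) \<in> bounded_ops S"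
    by (intro bounded_opsI[where C = C]) (auto simp: W_def fun_eq_iff algebra_simps)
  then show ?thesis by (rule bexI[rotated]) (simp add: Wf W0)
qed

locale companion_weights = fin_digraph G for G :: "('a, 'b) pre_digraph" +
  fixes l r :: "('a, 'b) weight"
  assumes left_weight: "left_weight G l"
    and left_bounded: "left_bounded G l"
    and right_companion: "right_companion G l r"
begin

lemma right_weight: "right_weight G r"
  using right_companion by (simp add: right_companion_def)

lemma left_pos: "composable G w v \<Longrightarrow> l v w > 0"
  using left_weight by (auto simp: left_weight_def composable_def)

lemma right_pos: "composable G v u \<Longrightarrow> r v u > 0"
  using right_weight by (auto simp: right_weight_def composable_def)

lemma right_nonneg: "v \<in> paths G \<Longrightarrow> u \<in> paths G \<Longrightarrow> r v u \<ge> 0"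
  using right_weight by (auto simp: right_weight_def)

lemma companion:
  "composable G w v \<Longrightarrow> composable G v u \<Longrightarrow> r (pcomp w v) u * l v w = l (pcomp v u) w * r v u"
  using right_companion unfolding right_companion_def by blast

lemma left_bounded_paths: "bounded_paths G l = paths G"
  using left_bounded by (auto simp: bounded_paths_def left_bounded_def)

text \<open>A vertex is idempotent under composition, so its weight at a composable path is a
  positive number equal to its own square; at any other path the weight is not positive.\<close>

lemma vertex_path_bounded:
  assumes v: "vertex_path x \<in> paths G" shows "vertex_path x \<in> bounded_paths G r"
proof -
  have "r v (vertex_path x) \<le> 1" if v': "v \<in> paths G" for v
  proof (cases "composable G v (vertex_path x)")
    case True
    have "composable G (vertex_path x) (vertex_path x)" using v by (simp add: composable_def)
    then have "r v (pcomp (vertex_path x) (vertex_path x))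
        = r (pcomp v (vertex_path x)) (vertex_path x) * r v (vertex_path x)"
      using right_weight True unfolding right_weight_def by blast
    moreover have "psource v = x" using True by (simp add: composable_def)
    ultimately have "r v (vertex_path x) = r v (vertex_path x) * r v (vertex_path x)"
      using pcomp_vertex_right[of v] by (simp add: pcomp_vertex_left)
    then show ?thesis using right_pos[OF True] by simp
  next
    case False
    then have "\<not> r v (vertex_path x) > 0" using right_weight v v' by (auto simp: right_weight_def)
    then show ?thesis by simp
  qed
  then have "weight_sup G r (vertex_path x) \<le> 1"
    unfolding weight_sup_def by (intro SUP_least) simp
  then have "weight_sup G r (vertex_path x) < \<infinity>"
    by (rule order.strict_trans1) simp
  then show ?thesis using v by (simp add: bounded_paths_def)
qed

text \<open>The conditions prescribe every coordinate of \<open>R x\<close> on the Hilbert space and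
  extensionality fixes \<open>R\<close> elsewhere, so at most one operator satisfies them.\<close>

definition right_shift :: "('a, 'b) path \<Rightarrow> ('a, 'b) path operator" where
  "right_shift u = (SOME R. R \<in> bounded_ops (paths G) \<and> (\<forall>x\<in>ell2 (paths G).
     (\<forall>v. composable G v u \<longrightarrow> R x (pcomp v u) = of_real (r v u) * x v) \<and>
     (\<forall>p. p \<notin> (\<lambda>v. pcomp v u) ` {v. composable G v u} \<longrightarrow> R x p = 0)))"

lemma right_shift:
  assumes u: "u \<in> bounded_paths G r"
  shows right_shift_in_bounded_ops: "right_shift u \<in> bounded_ops (paths G)"
    and right_shift_pcomp: "\<And>x v. x \<in> ell2 (paths G) \<Longrightarrow> composable G v u \<Longrightarrow>
      right_shift u x (pcomp v u) = of_real (r v u) * x v"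
    and right_shift_outside: "\<And>x p. x \<in> ell2 (paths G) \<Longrightarrow>
      p \<notin> (\<lambda>v. pcomp v u) ` {v. composable G v u} \<Longrightarrow> right_shift u x p = 0"
proof -
  let ?D = "{v. composable G v u}"
  let ?C = "enn2real (weight_sup G r u)"
  have uG: "u \<in> paths G" and fin: "weight_sup G r u < \<infinity>" using u by (auto simp: bounded_paths_def)
  have rC: "cmod (of_real (r v u)) \<le> ?C" if "v \<in> ?D" for v
  proof -
    have v: "v \<in> paths G" using that by (simp add: composable_def)
    have "ennreal (r v u) \<le> weight_sup G r u"
      unfolding weight_sup_def using v by (rule SUP_upper)
    then have "ennreal (r v u) \<le> ennreal ?C" using fin by simp
    then have "r v u \<le> ?C" by (subst (asm) ennreal_le_iff) auto
    then show ?thesis using right_nonneg[OF v uG] by simp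
  qed
  have D: "?D \<subseteq> paths G" by (auto simp: composable_def)
  have im: "(\<lambda>v. pcomp v u) ` ?D \<subseteq> paths G" using pcomp_path by blast
  have inj: "inj_on (\<lambda>v. pcomp v u) ?D"
    by (rule inj_onI, rule pcomp_right_cancel[of _ u]) (auto simp: composable_def)
  have "\<exists>R. R \<in> bounded_ops (paths G) \<and> (\<forall>x\<in>ell2 (paths G).
     (\<forall>v. composable G v u \<longrightarrow> R x (pcomp v u) = of_real (r v u) * x v) \<and>
     (\<forall>p. p \<notin> (\<lambda>v. pcomp v u) ` ?D \<longrightarrow> R x p = 0))"
    using ex_injective_shift[where S = "paths G", OF D inj im rC enn2real_nonneg]
    by (simp add: Bex_def)
  from someI_ex[OF this]
  have "right_shift u \<in> bounded_ops (paths G) \<and> (\<forall>x\<in>ell2 (paths G).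
     (\<forall>v. composable G v u \<longrightarrow> right_shift u x (pcomp v u) = of_real (r v u) * x v) \<and>
     (\<forall>p. p \<notin> (\<lambda>v. pcomp v u) ` ?D \<longrightarrow> right_shift u x p = 0))"
    unfolding right_shift_def[symmetric] .
  then show "right_shift u \<in> bounded_ops (paths G)"
    "\<And>x v. x \<in> ell2 (paths G) \<Longrightarrow> composable G v u \<Longrightarrow>
      right_shift u x (pcomp v u) = of_real (r v u) * x v"
    "\<And>x p. x \<in> ell2 (paths G) \<Longrightarrow> p \<notin> (\<lambda>v. pcomp v u) ` ?D \<Longrightarrow> right_shift u x p = 0"
    by blast+
qed

lemma right_shift_ket:
  assumes u: "u \<in> bounded_paths G r" and v: "v \<in> paths G"
  shows "right_shift u (ket v) =
    (if composable G v u then (\<lambda>p. of_real (r v u) * ket (pcomp v u) p) else (\<lambda>p. 0))"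
proof
  fix p
  note k = ket_in_ell2[OF v]
  show "right_shift u (ket v) p =
    (if composable G v u then (\<lambda>p. of_real (r v u) * ket (pcomp v u) p) else (\<lambda>p. 0)) p"
  proof (cases "p \<in> (\<lambda>v. pcomp v u) ` {v. composable G v u}")
    case True
    then obtain v' where v': "composable G v' u" "p = pcomp v' u" by auto
    have "v' = v" if "composable G v u" "pcomp v' u = pcomp v u"
      using that v'(1) by (intro pcomp_right_cancel[of v' u v]) (auto simp: composable_def)
    moreover have "right_shift u (ket v) p = of_real (r v' u) * ket v v'"
      unfolding v'(2) by (rule right_shift_pcomp[OF u k v'(1)])
    ultimately show ?thesis using v' by (auto simp: ket_def)
  next
    case False
    then show ?thesis using right_shift_outside[OF u k False] by (auto simp: ket_def)
  qed
qed

lemma weighted_shift_in_bounded_ops: "w \<in> paths G \<Longrightarrow> weighted_shift G l w \<in> bounded_ops (paths G)"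
  using weighted_shift_is_weighted_shift[OF fin_digraph_axioms left_weight]
  by (simp add: is_weighted_shift_def left_bounded_paths)

lemma weighted_shift_ket:
  assumes "w \<in> paths G" "v \<in> paths G"
  shows "weighted_shift G l w (ket v) =
    (if composable G w v then (\<lambda>p. of_real (l v w) * ket (pcomp w v) p) else (\<lambda>p. 0))"
  using weighted_shift_is_weighted_shift[OF fin_digraph_axioms left_weight] assms
  by (simp add: is_weighted_shift_def left_bounded_paths)

text \<open>It suffices to compare basis vectors. Appending \<open>u\<close> on the right does not
  affect whether \<open>w\<close> can follow \<open>v\<close>, and vice versa, so both products
  vanish unless both compositions exist; then the scalars agree by the companion identity and the
  paths by associativity.\<close>

lemma right_shift_commutes:
  assumes u: "u \<in> bounded_paths G r" and w: "w \<in> paths G"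
  shows "op_mult (paths G) (right_shift u) (weighted_shift G l w)
    = op_mult (paths G) (weighted_shift G l w) (right_shift u)"
proof (rule bounded_ops_eqI)
  let ?R = "right_shift u" and ?L = "weighted_shift G l w"
  have R: "?R \<in> bounded_ops (paths G)" by (rule right_shift_in_bounded_ops[OF u])
  have L: "?L \<in> bounded_ops (paths G)" by (rule weighted_shift_in_bounded_ops[OF w])
  show "op_mult (paths G) ?R ?L \<in> bounded_ops (paths G)"
    and "op_mult (paths G) ?L ?R \<in> bounded_ops (paths G)"
    using R L by (simp_all add: op_mult_in_bounded_ops)
  fix v assume v: "v \<in> paths G"
  have "?R (?L (ket v)) = ?L (?R (ket v))"
  proof (cases "composable G w v"; cases "composable G v u")
    assume c: "composable G w v" "composable G v u"
    have "?R (?L (ket v)) = (\<lambda>p. of_real (l v w) * (of_real (r (pcomp w v) u) * ket (pcomp (pcomp w v) u) p))"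
      using c composable_pcomp_left[OF c(1)] pcomp_path[OF c(1)]
      by (simp add: weighted_shift_ket[OF w v] bounded_ops_scale[OF R] ket_in_ell2 right_shift_ket[OF u])
    moreover have "?L (?R (ket v))
        = (\<lambda>p. of_real (r v u) * (of_real (l (pcomp v u) w) * ket (pcomp w (pcomp v u)) p))"
      using c composable_pcomp_right[OF c(2)] pcomp_path[OF c(2)]
      by (simp add: weighted_shift_ket[OF w] right_shift_ket[OF u v] bounded_ops_scale[OF L] ket_in_ell2)
    moreover have "complex_of_real (l v w) * of_real (r (pcomp w v) u)
        = of_real (r v u) * of_real (l (pcomp v u) w)"
      using companion[OF c] by (simp only: of_real_mult[symmetric] mult.commute)
    ultimately show ?thesis by (simp add: pcomp_assoc mult.assoc[symmetric])
  next
    assume c: "composable G w v" "\<not> composable G v u"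
    then show ?thesis
      using composable_pcomp_left[OF c(1)] pcomp_path[OF c(1)] bounded_ops_zero[OF L]
      by (simp add: weighted_shift_ket[OF w v] bounded_ops_scale[OF R] ket_in_ell2 right_shift_ket[OF u] v)
  next
    assume c: "\<not> composable G w v" "composable G v u"
    then show ?thesis
      using composable_pcomp_right[OF c(2)] pcomp_path[OF c(2)] bounded_ops_zero[OF R]
      by (simp add: weighted_shift_ket[OF w] right_shift_ket[OF u v] bounded_ops_scale[OF L] ket_in_ell2 v)
  next
    assume "\<not> composable G w v" "\<not> composable G v u"
    then show ?thesis
      by (simp add: weighted_shift_ket[OF w v] right_shift_ket[OF u v] bounded_ops_zero[OF L]
          bounded_ops_zero[OF R])
  qed
  then show "op_mult (paths G) ?R ?L (ket v) = op_mult (paths G) ?L ?R (ket v)"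
    by (simp add: op_mult_apply ket_in_ell2 v)
qed

lemma weighted_shifts_bounded: "weighted_shift G l ` bounded_paths G l \<subseteq> bounded_ops (paths G)"
  using weighted_shift_in_bounded_ops by (auto simp: left_bounded_paths)

lemma right_shift_in_commutant:
  assumes u: "u \<in> bounded_paths G r"
  shows "right_shift u \<in> commutant (paths G) (left_algebra G l)"
  unfolding left_algebra_def
proof (rule subsetD[OF commutant_subset_commutant_wot_algebra[OF weighted_shifts_bounded]])
  show "right_shift u \<in> commutant (paths G) (weighted_shift G l ` bounded_paths G l)"
    using right_shift_in_bounded_ops[OF u] right_shift_commutes[OF u]
    by (auto simp: commutant_def left_bounded_paths)
qed


section \<open>Operators commuting with the right shifts\<close>

context
  fixes T q u
  assumes T: "T \<in> bounded_ops (paths G)"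
    and comm: "\<And>u x. u \<in> bounded_paths G r \<Longrightarrow> x \<in> ell2 (paths G) \<Longrightarrow>
      T (right_shift u x) = right_shift u (T x)"
    and q: "q \<in> paths G" and u: "u \<in> bounded_paths G r"
    and qu: "composable G q u" "pcomp q u \<in> bounded_paths G r"
begin

text \<open>Both \<open>ket q\<close> and \<open>ket (vertex_path (prange G q))\<close> are carried to multiples of
  \<open>ket (pcomp q u)\<close> by right shifts, so that \<open>T (ket q)\<close> is determined by the value of \<open>T\<close> at
  a vertex.\<close>

lemma right_shift_vertex_eq:
  defines "x \<equiv> vertex_path (prange G q)"
  shows "of_real (r x (pcomp q u)) * right_shift u (T (ket q)) p
    = of_real (r q u) * right_shift (pcomp q u) (T (ket x)) p"
proof -
  have x: "x \<in> paths G" unfolding x_def by (rule vertex_path_prange[OF q])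
  have cx: "composable G x (pcomp q u)"
    using composable_vertex_left[OF pcomp_path[OF qu(1)]] by (simp add: x_def prange_pcomp[OF qu(1)])
  have k: "ket (pcomp q u) \<in> ell2 (paths G)" by (rule ket_in_ell2[OF pcomp_path[OF qu(1)]])
  have "right_shift u (T (ket q)) = T (\<lambda>p. of_real (r q u) * ket (pcomp q u) p)"
    using qu(1) by (simp add: comm[OF u ket_in_ell2[OF q], symmetric] right_shift_ket[OF u q])
  moreover have "right_shift (pcomp q u) (T (ket x))
      = T (\<lambda>p. of_real (r x (pcomp q u)) * ket (pcomp q u) p)"
    using cx by (simp add: comm[OF qu(2) ket_in_ell2[OF x], symmetric] right_shift_ket[OF qu(2) x])
      (simp add: x_def pcomp_vertex_left)
  ultimately show ?thesis by (simp add: bounded_ops_scale[OF T k])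
qed

text \<open>Commuting with the shift by the vertex \<open>psource q\<close> forces \<open>p\<close>
  to start where \<open>q\<close> does, so \<open>u\<close> can precede \<open>p\<close>. At the
  coordinate \<open>pcomp p u\<close> the left side of \<open>right_shift_vertex_eq\<close> is then
  nonzero, hence this path lies in the image of the shift by \<open>pcomp q u\<close>; cancelling
  \<open>u\<close> exhibits \<open>w\<close>.\<close>

lemma intertwiner_support:
  assumes p: "p \<in> paths G" and nz: "T (ket q) p \<noteq> 0"
  obtains w where "composable G w q" "p = pcomp w q"
proof -
  let ?x = "vertex_path (prange G q)" and ?y = "vertex_path (psource q)"
  have Tq: "T (ket q) \<in> ell2 (paths G)" by (rule bounded_ops_in_ell2[OF T ket_in_ell2[OF q]])
  have Tx: "T (ket ?x) \<in> ell2 (paths G)"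
    by (rule bounded_ops_in_ell2[OF T ket_in_ell2[OF vertex_path_prange[OF q]]])
  have y: "?y \<in> bounded_paths G r" by (rule vertex_path_bounded[OF vertex_path_psource[OF q]])
  have cy: "composable G q ?y" by (rule composable_vertex_right[OF q])
  have "right_shift ?y (T (ket q)) = T (\<lambda>p. of_real (r q ?y) * ket q p)"
    using cy by (simp add: comm[OF y ket_in_ell2[OF q], symmetric] right_shift_ket[OF y q] pcomp_vertex_right)
  then have "right_shift ?y (T (ket q)) p = of_real (r q ?y) * T (ket q) p"
    by (simp add: bounded_ops_scale[OF T ket_in_ell2[OF q]])
  then have "right_shift ?y (T (ket q)) p \<noteq> 0" using nz right_pos[OF cy] by simp
  then have "p \<in> (\<lambda>v. pcomp v ?y) ` {v. composable G v ?y}"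
    using right_shift_outside[OF y Tq] by blast
  then have sp: "psource p = psource q" by auto
  then have cp: "composable G p u" using p qu(1) by (simp add: composable_def)
  have cx: "composable G ?x (pcomp q u)"
    using composable_vertex_left[OF pcomp_path[OF qu(1)]] by (simp add: prange_pcomp[OF qu(1)])
  have "of_real (r ?x (pcomp q u)) * right_shift u (T (ket q)) (pcomp p u) \<noteq> 0"
    using nz right_pos[OF cx] right_pos[OF cp] by (simp add: right_shift_pcomp[OF u Tq cp])
  then have "right_shift (pcomp q u) (T (ket ?x)) (pcomp p u) \<noteq> 0"
    unfolding right_shift_vertex_eq by auto
  then have "pcomp p u \<in> (\<lambda>v. pcomp v (pcomp q u)) ` {v. composable G v (pcomp q u)}"
    using right_shift_outside[OF qu(2) Tx] by blast
  then obtain v where v: "composable G v q" "pcomp p u = pcomp (pcomp v q) u"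
    using composable_pcomp_right[OF qu(1)] by (auto simp: pcomp_assoc)
  then show thesis using that pcomp_right_cancel[OF v(2)] sp by simp
qed

text \<open>The quotient on the right depends on \<open>w\<close> alone, so the matrix of
  \<open>T\<close> is that of a series in the shifts. Reading \<open>right_shift_vertex_eq\<close>
  at the path \<open>wqu\<close> relates the two coefficients of \<open>T\<close> through values of
  \<open>r\<close>; two companion identities with the common factor \<open>l ?qu w\<close> turn
  these into values of \<open>l\<close>.\<close>

lemma intertwiner_coefficient:
  assumes w: "composable G w q"
  shows "T (ket q) (pcomp w q) = of_real (l q w)
    * (T (ket (vertex_path (psource w))) w / of_real (l (vertex_path (psource w)) w))"
proof -
  let ?x = "vertex_path (psource w)" and ?qu = "pcomp q u"
  have wG: "w \<in> paths G" using w by (simp add: composable_def)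
  have sw: "psource w = prange G q" using w by (simp add: composable_def)
  have Tq: "T (ket q) \<in> ell2 (paths G)" by (rule bounded_ops_in_ell2[OF T ket_in_ell2[OF q]])
  have Tx: "T (ket ?x) \<in> ell2 (paths G)"
    by (rule bounded_ops_in_ell2[OF T ket_in_ell2[OF vertex_path_psource[OF wG]]])
  have cx: "composable G ?x ?qu"
    using composable_vertex_left[OF pcomp_path[OF qu(1)]] by (simp add: prange_pcomp[OF qu(1)] sw)
  have cw: "composable G w ?x" by (rule composable_vertex_right[OF wG])
  have cwu: "composable G (pcomp w q) u" using composable_pcomp_left[OF w] qu(1) by simp
  have cwqu: "composable G w ?qu" using composable_pcomp_right[OF qu(1)] w by simp
  let ?t = "T (ket q) (pcomp w q)" and ?s = "T (ket ?x) w"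
  have 1: "of_real (r ?x ?qu) * (of_real (r (pcomp w q) u) * ?t) = of_real (r q u) * (of_real (r w ?qu) * ?s)"
    using right_shift_vertex_eq[of "pcomp (pcomp w q) u"] right_shift_pcomp[OF u Tq cwu]
      right_shift_pcomp[OF qu(2) Tx cwqu] by (simp add: pcomp_assoc sw)
  have 2: "r w ?qu * l ?x w = l ?qu w * r ?x ?qu"
    using companion[OF cw cx] by (simp add: pcomp_vertex_right pcomp_vertex_left)
  have 3: "r (pcomp w q) u * l q w = l ?qu w * r q u" by (rule companion[OF w qu(1)])
  define a b c d e f where abc: "a = complex_of_real (r ?x ?qu)" "b = complex_of_real (r (pcomp w q) u)"
    "c = complex_of_real (r q u)" "d = complex_of_real (r w ?qu)" "e = complex_of_real (l ?x w)"
    "f = complex_of_real (l q w)"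
  have nz: "a \<noteq> 0" "b \<noteq> 0" "e \<noteq> 0"
    using right_pos[OF cx] right_pos[OF cwu] left_pos[OF cw] by (simp_all add: abc)
  define g where "g = complex_of_real (l ?qu w)"
  have 1: "a * (b * ?t) = c * (d * ?s)" using 1 by (simp add: abc)
  have 2: "d * e = g * a" and 3: "b * f = g * c"
    using 2 3 by (simp_all only: abc g_def of_real_mult[symmetric])
  \<comment> \<open>Multiplying by the nonzero scalar \<open>a * b\<close> avoids divisions:
    \<open>g * a * c\<close> arises from both companion identities and links the two sides.\<close>
  have "(a * b) * (?t * e) = e * (a * (b * ?t))" by (simp add: algebra_simps)
  also have "\<dots> = c * (d * e) * ?s" unfolding 1 by (simp add: algebra_simps)
  also have "\<dots> = a * (b * f) * ?s" unfolding 2 3 by (simp add: algebra_simps)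
  also have "\<dots> = (a * b) * (f * ?s)" by (simp add: algebra_simps)
  finally have "?t * e = f * ?s" using nz by simp
  then have "?t = f * (?s / e)" using nz by (simp add: field_simps)
  then show ?thesis by (simp add: abc)
qed

end

end


section \<open>Recovery of an operator in the double commutant from its Cesaro sums\<close>

theorem theorem4p4:
  fixes G :: "('a, 'b) pre_digraph"
    and l r :: "('a, 'b) weight"
  assumes "fin_digraph G"
    and "left_weight G l"
    and "left_bounded G l"
    and "canonical_right_companion G l r"
    and "\<And>v. v \<in> paths G \<Longrightarrow>
      \<exists>u\<in>bounded_paths G r. composable G v u \<and> pcomp v u \<in> bounded_paths G r"
  shows "commutant (paths G) (commutant (paths G) (left_algebra G l)) = left_algebra G l"
proof
  interpret companion_weights G l r
    using assms(1-4)
    by (auto simp: companion_weights_def companion_weights_axioms_def canonical_right_companion_def)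
  let ?S = "paths G"
  let ?LA = "left_algebra G l"
  have sub: "?LA \<subseteq> bounded_ops ?S" and cl: "closedin (wot ?S) ?LA"
    and alg: "unital_operator_algebra ?S ?LA" and gen: "weighted_shift G l ` ?S \<subseteq> ?LA"
    using wot_algebra_subset_bounded_ops[OF weighted_shifts_bounded]
      closedin_wot_algebra[OF weighted_shifts_bounded]
      unital_operator_algebra_wot_algebra[OF weighted_shifts_bounded]
      subset_wot_algebra[OF weighted_shifts_bounded]
    by (simp_all add: left_algebra_def left_bounded_paths)
  show "?LA \<subseteq> commutant ?S (commutant ?S ?LA)" by (rule subset_double_commutant[OF sub])
  show "commutant ?S (commutant ?S ?LA) \<subseteq> ?LA"
  proof
    fix T assume T': "T \<in> commutant ?S (commutant ?S ?LA)"
    then have T: "T \<in> bounded_ops ?S" by (simp add: commutant_def)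
    have comm: "T (right_shift u x) = right_shift u (T x)"
      if "u \<in> bounded_paths G r" "x \<in> ell2 ?S" for u x
      using T' right_shift_in_commutant[OF that(1)] that(2) by (simp add: commutant_iff)
    define a where "a w = T (ket (vertex_path (psource w))) w / of_real (l (vertex_path (psource w)) w)" for w
    define len :: "('a, 'b) path \<Rightarrow> nat" where "len p = length (snd p)" for p
    define W where "W k = {w \<in> ?S. len w < Suc k}" for k
    \<comment> \<open>For \<open>p = pcomp w q\<close> the degrees differ by \<open>len w\<close>,
      so this factor is the Fejer multiplier of the entry. Truncated subtraction makes it zero
      outside \<open>W k\<close>.\<close>
    define c where "c k w = complex_of_real (real (Suc k - len w) / real (Suc k)) * a w" for k w
    have fW: "finite (W k)" for k unfolding W_def len_def by (rule finite_short_paths)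
    have "\<exists>A\<in>?LA. \<forall>x\<in>ell2 ?S. \<forall>p. A x p = (\<Sum>w\<in>W k. c k w * weighted_shift G l w x p)" for k
      using gen by (intro unital_operator_algebra_sum[OF alg fW]) (auto simp: W_def)
    then obtain A where A: "\<And>k. A k \<in> ?LA"
      and Asum: "\<And>k x p. x \<in> ell2 ?S \<Longrightarrow> A k x p = (\<Sum>w\<in>W k. c k w * weighted_shift G l w x p)"
      by metis
    have "A k (ket q) p = of_real (fejer (Suc k) (len p) (len q)) * T (ket q) p"
      if p: "p \<in> ?S" and q: "q \<in> ?S" for k p q
    proof -
      obtain u where u: "u \<in> bounded_paths G r" "composable G q u" "pcomp q u \<in> bounded_paths G r"
        using assms(5)[OF q] by blast
      have Aq: "A k (ket q) p = (\<Sum>w\<in>W k. c k w *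
          (if composable G w q \<and> p = pcomp w q then of_real (l q w) else 0))"
        unfolding Asum[OF ket_in_ell2[OF q]]
        using q by (intro sum.cong refl) (subst weighted_shift_ket, auto simp: W_def ket_def)
      show ?thesis
      proof (cases "\<exists>w. composable G w q \<and> p = pcomp w q")
        case True
        then obtain w where w: "composable G w q" "p = pcomp w q" by blast
        \<comment> \<open>Composability with \<open>q\<close> fixes the source of \<open>w'\<close>,
          so right cancellation applies and a single summand survives.\<close>
        have "w' = w" if "composable G w' q" "pcomp w q = pcomp w' q" for w'
          using pcomp_right_cancel[OF that(2)] that(1) w(1) by (simp add: composable_def)
        then have "A k (ket q) p = (\<Sum>w'\<in>W k. if w' = w then c k w * of_real (l q w) else 0)"
          unfolding Aq using w by (intro sum.cong refl) auto
        also have "\<dots> = (if w \<in> W k then c k w * of_real (l q w) else 0)"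
          using fW by simp
        also have "\<dots> = c k w * of_real (l q w)"
          using w(1) by (auto simp: W_def c_def composable_def)
        also have "\<dots> = of_real (fejer (Suc k) (len p) (len q)) * T (ket q) p"
        proof -
          have "len p = len w + len q" unfolding w(2) len_def by (rule length_snd_pcomp)
          then have "fejer (Suc k) (len p) (len q) = real (Suc k - len w) / real (Suc k)"
            by (simp add: fejer_def)
          moreover have "T (ket q) p = of_real (l q w) * a w"
            unfolding w(2) a_def by (rule intertwiner_coefficient[OF T comm q u w(1)])
          ultimately show ?thesis by (simp add: c_def)
        qed
        finally show ?thesis .
      next
        case False
        \<comment> \<open>Without a factorization of \<open>p\<close> through \<open>q\<close>, no
          shift has a nonzero entry at this position, and by \<open>intertwiner_support\<close>
          neither has \<open>T\<close>.\<close>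
        then have "A k (ket q) p = 0" unfolding Aq by (intro sum.neutral) auto
        moreover have "T (ket q) p = 0"
          using intertwiner_support[OF T comm q u p] False by blast
        ultimately show ?thesis by simp
      qed
    qed
    then have "limitin (wot ?S) A T sequentially"
      using A sub by (intro limitin_fejer[OF T, where len = len]) blast+
    then show "T \<in> ?LA"
      using A by (intro limitin_closedin[OF _ cl]) auto
  qed
qed

end
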